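(* Let $T\in\mathcal{A}_1[\mathbb{R}]$ be an operator whose symbol $F_T(z,w)$ has degree $d$, and let $\tilde F_T(y,z,w)$ be the (unique) homogeneous polynomial of degree $d$ such that $\tilde F_T(1,z,w)=F_T(z,-w)$. Then $T\in\mathcal{A}_1(\mathbb{R})$ if and only if the following conditions hold: (i) $\tilde F_T(y,z,w)$ is hyperbolic with respect to $(0,1,1)$; (ii) all zeros of the univariate polynomial $\tilde F_T(0,t,1)$ lie in $(-\infty,0]$.
   Context: $\mathcal{A}_1[\mathbb{R}]$ is the set of finite order linear differential operators $T=\sum_{j,k\ge 0}a_{jk}z^j\,\frac{d^k}{dz^k}$ (finite sum, $a_{jk}\in\mathbb{R}$) on polynomials in $z$; the symbol of $T$ is $F_T(z,w)=\sum_{j,k}a_{jk}z^jw^k$, and its degree is its total degree in $z,w$ (so $T\ne 0$). $\mathcal{H}_1(\mathbb{R})$ is the set of nonzero real univariate polynomials with only real zeros, and $\mathcal{A}_1(\mathbb{R})$ is the set of nonzero $T\in\mathcal{A}_1[\mathbb{R}]$ with $T(\mathcal{H}_1(\mathbb{R}))\subseteq\mathcal{H}_1(\mathbb{R})\cup\{0\}$. A homogeneous polynomial $p\in\mathbb{R}[x_1,\ldots,x_m]$ is (Gårding) hyperbolic with respect to $v\in\mathbb{R}^m$ if $p(v)\neq 0$ and for all $\alpha\in\mathbb{R}^m$ the univariate polynomial $p(\alpha+vt)\in\mathbb{R}[t]$ has only real zeros. *)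

theory Defs
  imports "HOL-Analysis.Analysis" "HOL-Library.Poly_Mapping"
begin

text \<open>Real polynomials in variables indexed by the finite type \<open>'n\<close>: finitely supported maps from
  exponent vectors to coefficients. Index types \<open>2\<close> and \<open>3\<close> are used for the variables
  \<open>(z, w)\<close> and \<open>(y, z, w)\<close>, matching the order of the entries in \<^const>\<open>vector\<close>.\<close>

type_synonym 'n mpoly = "('n \<Rightarrow>\<^sub>0 nat) \<Rightarrow>\<^sub>0 real"

text \<open>Substitution of \<open>x\<close> for the variables, with values in a commutative ring into which the
  coefficients are embedded by \<open>c\<close>.\<close>

definition msubst :: "(real \<Rightarrow> 'b::comm_semiring_1) \<Rightarrow> 'n::finite mpoly \<Rightarrow> 'b ^ 'n \<Rightarrow> 'b" where
  "msubst c p x =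
     (\<Sum>m\<in>Poly_Mapping.keys p. c (Poly_Mapping.lookup p m) *
        (\<Prod>i\<in>UNIV. (x $ i) ^ Poly_Mapping.lookup m i))"

abbreviation meval :: "'n::finite mpoly \<Rightarrow> real ^ 'n \<Rightarrow> real" where
  "meval \<equiv> msubst (\<lambda>a. a)"

abbreviation msubst_poly :: "'n::finite mpoly \<Rightarrow> real poly ^ 'n \<Rightarrow> real poly" where
  "msubst_poly \<equiv> msubst (\<lambda>a. [:a:])"

definition monom_degree :: "('n::finite \<Rightarrow>\<^sub>0 nat) \<Rightarrow> nat" where
  "monom_degree m = (\<Sum>i\<in>UNIV. Poly_Mapping.lookup m i)"

text \<open>The convention here is that the zero polynomial has total degree \<open>0\<close>.\<close>

definition total_degree :: "'n::finite mpoly \<Rightarrow> nat" where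
  "total_degree p = Max (insert 0 (monom_degree ` Poly_Mapping.keys p))"

definition homogeneous :: "nat \<Rightarrow> 'n::finite mpoly \<Rightarrow> bool" where
  "homogeneous d p \<longleftrightarrow> (\<forall>m\<in>Poly_Mapping.keys p. monom_degree m = d)"

definition complex_zeros :: "real poly \<Rightarrow> complex set" where
  "complex_zeros p = {\<zeta>. poly (map_poly complex_of_real p) \<zeta> = 0}"

definition only_real_zeros :: "real poly \<Rightarrow> bool" where
  "only_real_zeros p \<longleftrightarrow> complex_zeros p \<subseteq> \<real>"

text \<open>The polynomial \<open>p(\<alpha> + v t)\<close> in \<open>t\<close> is obtained by substituting the linear polynomials
  \<open>\<alpha> $ i + (v $ i) t\<close>.\<close>

definition garding_hyperbolic :: "'n::finite mpoly \<Rightarrow> real ^ 'n \<Rightarrow> bool" where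
  "garding_hyperbolic p v \<longleftrightarrow>
     (\<exists>d. homogeneous d p) \<and> meval p v \<noteq> 0 \<and>
     (\<forall>\<alpha>. only_real_zeros (msubst_poly p (\<chi> i. [:\<alpha> $ i, v $ i:])))"

text \<open>Nonzero real polynomials all of whose zeros are real; nonzero constants are included.\<close>

definition real_rooted :: "real poly set" where
  "real_rooted = {p. p \<noteq> 0 \<and> only_real_zeros p}"

text \<open>The operator \<open>\<Sum> a\<^sub>j\<^sub>k z\<^sup>j (d/dz)\<^sup>k\<close>, where \<open>a\<^sub>j\<^sub>k\<close> is the coefficient in \<open>F\<close> of the monomial with
  exponent \<open>j\<close> at variable \<open>1\<close> and exponent \<open>k\<close> at variable \<open>2\<close>.\<close>

definition diff_op :: "2 mpoly \<Rightarrow> real poly \<Rightarrow> real poly" where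
  "diff_op F f =
     (\<Sum>m\<in>Poly_Mapping.keys F.
        monom (Poly_Mapping.lookup F m) (Poly_Mapping.lookup m 1) *
        (pderiv ^^ Poly_Mapping.lookup m 2) f)"

definition diff_ops :: "(real poly \<Rightarrow> real poly) set" where
  "diff_ops = range diff_op"

text \<open>Well defined on \<open>diff_ops\<close> by lemma \<open>inj_diff_op\<close>.\<close>

definition op_symbol :: "(real poly \<Rightarrow> real poly) \<Rightarrow> 2 mpoly" where
  "op_symbol T = (THE F. diff_op F = T)"

definition hyperbolicity_preservers :: "(real poly \<Rightarrow> real poly) set" where
  "hyperbolicity_preservers =
     {T \<in> diff_ops. T \<noteq> (\<lambda>_. 0) \<and> T ` real_rooted \<subseteq> real_rooted \<union> {0}}"

text \<open>\<open>G(y, z, w)\<close> is homogeneous of degree \<open>d\<close> and \<open>G(1, z, w) = F(z, -w)\<close>.\<close>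

definition is_homogenization :: "nat \<Rightarrow> 2 mpoly \<Rightarrow> 3 mpoly \<Rightarrow> bool" where
  "is_homogenization d F G \<longleftrightarrow>
     homogeneous d G \<and> (\<forall>z w. meval G (vector [1, z, w]) = meval F (vector [z, - w]))"

subsection \<open>Well-definedness of the symbol and of the homogenization\<close>

definition expo2 :: "nat \<Rightarrow> nat \<Rightarrow> (2 \<Rightarrow>\<^sub>0 nat)" where
  "expo2 j k = Poly_Mapping.single 1 j + Poly_Mapping.single 2 k"

definition expo3 :: "nat \<Rightarrow> nat \<Rightarrow> nat \<Rightarrow> (3 \<Rightarrow>\<^sub>0 nat)" where
  "expo3 i j k = Poly_Mapping.single 1 i + Poly_Mapping.single 2 j + Poly_Mapping.single 3 k"

lemma prod_UNIV_2: "(\<Prod>i\<in>(UNIV::2 set). f i) = f 1 * f 2"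
  unfolding UNIV_2 by simp

lemma prod_UNIV_3: "(\<Prod>i\<in>(UNIV::3 set). f i) = f 1 * f 2 * f 3"
  unfolding UNIV_3 by (simp add: ac_simps)

lemma lookup_expo2 [simp]:
  "Poly_Mapping.lookup (expo2 j k) 1 = j" "Poly_Mapping.lookup (expo2 j k) 2 = k"
  by (simp_all add: expo2_def lookup_add lookup_single)

lemma lookup_expo3 [simp]:
  "Poly_Mapping.lookup (expo3 i j k) 1 = i" "Poly_Mapping.lookup (expo3 i j k) 2 = j"
  "Poly_Mapping.lookup (expo3 i j k) 3 = k"
  by (simp_all add: expo3_def lookup_add lookup_single)

lemma expo2_eqI:
  assumes "Poly_Mapping.lookup m 1 = Poly_Mapping.lookup m' 1"
      and "Poly_Mapping.lookup m 2 = Poly_Mapping.lookup m' (2::2)"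
  shows "m = m'"
proof (rule poly_mapping_eqI)
  fix i
  show "Poly_Mapping.lookup m i = Poly_Mapping.lookup m' i"
    using exhaust_2[of i] assms by (elim disjE) simp_all
qed

lemma expo3_eqI:
  assumes "Poly_Mapping.lookup m 1 = Poly_Mapping.lookup m' 1"
      and "Poly_Mapping.lookup m 2 = Poly_Mapping.lookup m' 2"
      and "Poly_Mapping.lookup m 3 = Poly_Mapping.lookup m' (3::3)"
  shows "m = m'"
proof (rule poly_mapping_eqI)
  fix i
  show "Poly_Mapping.lookup m i = Poly_Mapping.lookup m' i"
    using exhaust_3[of i] assms by (elim disjE) simp_all
qed

lemma diff_op_superset:
  assumes "finite A" "Poly_Mapping.keys F \<subseteq> A"
  shows "diff_op F f = (\<Sum>m\<in>A. monom (Poly_Mapping.lookup F m) (Poly_Mapping.lookup m 1) *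
           (pderiv ^^ Poly_Mapping.lookup m 2) f)"
  unfolding diff_op_def
  by (rule sum.mono_neutral_left) (use assms in \<open>auto simp: in_keys_iff\<close>)

lemma msubst_superset:
  assumes "finite A" "Poly_Mapping.keys p \<subseteq> A" "c 0 = 0"
  shows "msubst c p x = (\<Sum>m\<in>A. c (Poly_Mapping.lookup p m) *
           (\<Prod>i\<in>UNIV. (x $ i) ^ Poly_Mapping.lookup m i))"
  unfolding msubst_def
  by (rule sum.mono_neutral_left) (use assms in \<open>auto simp: in_keys_iff\<close>)

lemma diff_op_diff: "diff_op (F - G) f = diff_op F f - diff_op G f"
proof -
  let ?A = "Poly_Mapping.keys F \<union> Poly_Mapping.keys G \<union> Poly_Mapping.keys (F - G)"
  have "finite ?A" by simp
  then show ?thesis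
    by (subst (1 2 3) diff_op_superset[of ?A])
       (auto simp: lookup_minus diff_monom[symmetric] algebra_simps sum_subtractf)
qed

lemma meval_diff: "meval (p - q) x = meval p x - meval q x"
proof -
  let ?A = "Poly_Mapping.keys p \<union> Poly_Mapping.keys q \<union> Poly_Mapping.keys (p - q)"
  have "finite ?A" by simp
  then show ?thesis
    by (subst (1 2 3) msubst_superset[of ?A])
       (auto simp: lookup_minus algebra_simps sum_subtractf)
qed

lemma higher_pderiv_monom_one:
  fixes n :: nat
  shows "(pderiv ^^ n) (monom (1::real) n) = [:fact n:]"
        "k > n \<Longrightarrow> (pderiv ^^ k) (monom (1::real) n) = 0"
proof -
  show *: "(pderiv ^^ n) (monom (1::real) n) = [:fact n:]" for n
  proof (induction n)
    case (Suc n)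
    have "(pderiv ^^ Suc n) (monom (1::real) (Suc n)) =
          (pderiv ^^ n) (smult (real (Suc n)) (monom 1 n))"
      by (simp del: funpow.simps add: funpow_Suc_right pderiv_monom smult_monom)
    then show ?case
      by (simp del: funpow.simps add: higher_pderiv_smult Suc)
  qed (simp add: monom_0)
  show "(pderiv ^^ k) (monom (1::real) n) = 0" if "k > n"
  proof -
    have "pderiv ^^ k = (pderiv ^^ (k - Suc n) :: real poly \<Rightarrow> _) \<circ> pderiv ^^ Suc n"
      unfolding funpow_add[symmetric] using that by simp
    then have "(pderiv ^^ k) (monom (1::real) n) =
        (pderiv ^^ (k - Suc n)) (pderiv ((pderiv ^^ n) (monom 1 n)))"
      by (simp only: o_apply funpow.simps)
    also have "(pderiv ^^ n) (monom (1::real) n) = [:fact n:]"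
      by (rule *)
    also have "pderiv [:fact n:] = (0 :: real poly)"
      by (simp add: pderiv_pCons)
    finally show ?thesis
      by (simp only: higher_pderiv_0)
  qed
qed

lemma inj_diff_op: "inj diff_op"
proof (rule injI, rule ccontr)
  fix F G assume eq: "diff_op F = diff_op G" and ne: "F \<noteq> G"
  define H where "H = F - G"
  have zero: "diff_op H f = 0" for f
    by (simp add: H_def diff_op_diff eq)
  from ne have "Poly_Mapping.keys H \<noteq> {}"
    by (simp add: H_def)
  then obtain m0 where m0: "m0 \<in> Poly_Mapping.keys H"
    and min: "\<And>m. m \<in> Poly_Mapping.keys H \<Longrightarrow> Poly_Mapping.lookup m0 2 \<le> Poly_Mapping.lookup m 2"
    using ex_has_least_nat[of "\<lambda>m. m \<in> Poly_Mapping.keys H" _ "\<lambda>m. Poly_Mapping.lookup m 2"]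
    by blast
  define n where "n = Poly_Mapping.lookup m0 2"
  have "0 = coeff (diff_op H (monom 1 n)) (Poly_Mapping.lookup m0 1)"
    by (simp add: zero)
  also have "\<dots> = (\<Sum>m\<in>Poly_Mapping.keys H. if m = m0 then Poly_Mapping.lookup H m * fact n else 0)"
    unfolding diff_op_def coeff_sum
  proof (rule sum.cong[OF refl])
    fix m assume m: "m \<in> Poly_Mapping.keys H"
    show "coeff (monom (Poly_Mapping.lookup H m) (Poly_Mapping.lookup m 1) *
             (pderiv ^^ Poly_Mapping.lookup m 2) (monom 1 n)) (Poly_Mapping.lookup m0 1) =
          (if m = m0 then Poly_Mapping.lookup H m * fact n else 0)"
    proof (cases "Poly_Mapping.lookup m 2 = n")
      case True
      then have "m = m0 \<longleftrightarrow> Poly_Mapping.lookup m 1 = Poly_Mapping.lookup m0 1"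
        using expo2_eqI n_def by metis
      then show ?thesis
        by (simp add: True higher_pderiv_monom_one mult.commute)
    next
      case False
      then have "Poly_Mapping.lookup m 2 > n"
        using min[OF m] n_def by simp
      then show ?thesis
        using False by (auto simp: higher_pderiv_monom_one n_def)
    qed
  qed
  also have "\<dots> = Poly_Mapping.lookup H m0 * fact n"
    using m0 by simp
  finally show False
    using m0 by (simp add: in_keys_iff)
qed

lemma op_symbol_diff_op: "op_symbol (diff_op F) = F"
  unfolding op_symbol_def by (simp add: inj_eq[OF inj_diff_op])

lemma bivariate_zero:
  fixes c :: "nat \<times> nat \<Rightarrow> real"
  assumes "finite A" "\<And>z w. (\<Sum>x\<in>A. c x * (z ^ fst x * w ^ snd x)) = 0" "x0 \<in> A"
  shows "c x0 = 0"
proof -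
  define P where "P z = (\<Sum>x\<in>A. monom (c x * z ^ fst x) (snd x))" for z
  have "poly (P z) w = (\<Sum>x\<in>A. c x * (z ^ fst x * w ^ snd x))" for z w
    by (simp add: P_def poly_sum poly_monom mult.assoc)
  then have "\<forall>w. poly (P z) w = 0" for z
    using assms(2) by simp
  then have P0: "P z = 0" for z
    using poly_all_0_iff_0[of "P z"] by blast
  define Q where "Q = (\<Sum>x\<in>A. monom (if snd x = snd x0 then c x else 0) (fst x))"
  have "poly Q z = coeff (P z) (snd x0)" for z
    unfolding P_def Q_def poly_sum coeff_sum by (rule sum.cong) (simp_all add: poly_monom)
  then have "\<forall>z. poly Q z = 0"
    by (simp add: P0)
  then have "Q = 0"
    using poly_all_0_iff_0[of Q] by blast
  then have "0 = coeff Q (fst x0)" by simp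
  also have "\<dots> = (\<Sum>x\<in>A. if x = x0 then c x else 0)"
    unfolding Q_def coeff_sum by (rule sum.cong) (auto simp: prod_eq_iff)
  also have "\<dots> = c x0"
    using assms(1,3) by simp
  finally show ?thesis by simp
qed

lemma is_homogenization_unique:
  assumes "is_homogenization d F G" "is_homogenization d F G'"
  shows "G = G'"
proof (rule ccontr)
  assume "G \<noteq> G'"
  define H where "H = G - G'"
  define h where "h m = (Poly_Mapping.lookup m 2, Poly_Mapping.lookup m (3::3))" for m :: "3 \<Rightarrow>\<^sub>0 nat"
  have "H \<noteq> 0"
    using \<open>G \<noteq> G'\<close> by (simp add: H_def)
  then obtain m0 where m0: "m0 \<in> Poly_Mapping.keys H"
    by fastforce
  have hom: "monom_degree m = d" if "m \<in> Poly_Mapping.keys H" for m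
  proof -
    have "m \<in> Poly_Mapping.keys G \<or> m \<in> Poly_Mapping.keys G'"
      using that by (auto simp: H_def in_keys_iff lookup_minus)
    then show ?thesis
      using assms by (auto simp: is_homogenization_def homogeneous_def)
  qed
  have inj: "inj_on h (Poly_Mapping.keys H)"
  proof (rule inj_onI)
    fix m m' assume "m \<in> Poly_Mapping.keys H" "m' \<in> Poly_Mapping.keys H" "h m = h m'"
    then show "m = m'"
      using hom[of m] hom[of m'] by (intro expo3_eqI) (auto simp: h_def monom_degree_def sum_3)
  qed
  define c where "c x = Poly_Mapping.lookup H (inv_into (Poly_Mapping.keys H) h x)" for x
  have "(\<Sum>x\<in>h ` Poly_Mapping.keys H. c x * (z ^ fst x * w ^ snd x)) = 0" for z w
  proof -
    have "(\<Sum>x\<in>h ` Poly_Mapping.keys H. c x * (z ^ fst x * w ^ snd x)) =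
          (\<Sum>m\<in>Poly_Mapping.keys H. Poly_Mapping.lookup H m * (z ^ fst (h m) * w ^ snd (h m)))"
      unfolding sum.reindex[OF inj] by (rule sum.cong) (simp_all add: c_def inj)
    also have "\<dots> = meval H (vector [1, z, w])"
      unfolding msubst_def by (rule sum.cong) (simp_all add: prod_UNIV_3 h_def)
    also have "\<dots> = 0"
      using assms by (simp add: H_def meval_diff is_homogenization_def)
    finally show ?thesis .
  qed
  from bivariate_zero[OF _ this, of "h m0"] have "c (h m0) = 0"
    using m0 by simp
  then show False
    using m0 inj by (simp add: c_def in_keys_iff)
qed

lemma is_homogenization_exists:
  assumes "total_degree F \<le> d"
  shows "\<exists>G. is_homogenization d F G"
proof -
  define e where "e m = expo3 (d - monom_degree m) (Poly_Mapping.lookup m 1) (Poly_Mapping.lookup m 2)"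
    for m :: "2 \<Rightarrow>\<^sub>0 nat"
  define s where "s m = (- 1) ^ Poly_Mapping.lookup m 2 * Poly_Mapping.lookup F m" for m
  define G where "G = (\<Sum>m\<in>Poly_Mapping.keys F. Poly_Mapping.single (e m) (s m))"
  have inj: "inj e"
  proof (rule injI)
    fix m m' assume "e m = e m'"
    then have "Poly_Mapping.lookup (e m) i = Poly_Mapping.lookup (e m') i" for i
      by simp
    from this[of 2] this[of 3] show "m = m'"
      by (intro expo2_eqI) (simp_all add: e_def)
  qed
  have deg: "monom_degree m \<le> d" if "m \<in> Poly_Mapping.keys F" for m
    using assms that by (simp add: total_degree_def)
  have lookG: "Poly_Mapping.lookup G (e m) = s m" for m
  proof -
    have "Poly_Mapping.lookup G (e m) = (\<Sum>m'\<in>Poly_Mapping.keys F. if m' = m then s m' else 0)"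
      using inj by (auto simp: G_def lookup_sum lookup_single inj_eq when_def intro!: sum.cong)
    then show ?thesis
      by (auto simp: s_def in_keys_iff)
  qed
  have keys: "Poly_Mapping.keys G \<subseteq> e ` Poly_Mapping.keys F"
    unfolding G_def by (rule order.trans[OF Poly_Mapping.keys_sum]) auto
  have "homogeneous d G"
    unfolding homogeneous_def
  proof
    fix m assume "m \<in> Poly_Mapping.keys G"
    then obtain m' where "m' \<in> Poly_Mapping.keys F" "m = e m'"
      using keys by auto
    then show "monom_degree m = d"
      using deg[of m'] by (simp add: e_def monom_degree_def sum_3 sum_2)
  qed
  moreover have "meval G (vector [1, z, w]) = meval F (vector [z, - w])" for z w
  proof -
    have "meval G (vector [1, z, w]) =
      (\<Sum>m\<in>e ` Poly_Mapping.keys F. Poly_Mapping.lookup G m *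
         (z ^ Poly_Mapping.lookup m 2 * w ^ Poly_Mapping.lookup m 3))"
      by (subst msubst_superset[OF _ keys]) (simp_all add: prod_UNIV_3 mult_ac)
    also have "\<dots> =
      (\<Sum>m\<in>Poly_Mapping.keys F. s m * (z ^ Poly_Mapping.lookup m 1 * w ^ Poly_Mapping.lookup m 2))"
      by (subst sum.reindex[OF inj_on_subset[OF inj]]) (simp_all add: lookG, simp add: e_def)
    also have "\<dots> = meval F (vector [z, - w])"
      by (auto simp: msubst_def s_def prod_UNIV_2 power_minus[of w] mult_ac intro!: sum.cong)
    finally show ?thesis .
  qed
  ultimately show ?thesis
    by (auto simp: is_homogenization_def)
qed

end

theory Submission
  imports Defs "HOL-Complex_Analysis.Complex_Analysis"
    "HOL-Computational_Algebra.Fundamental_Theorem_Algebra"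
begin

text \<open>
  Both sides are equivalent to stability: \<open>P(z, w) = F(z, -w)\<close> has no zero with both arguments in the open
  upper half-plane.

  If \<open>T\<close> preserves real-rootedness, apply it to all real combinations of the real and imaginary parts of
  \<open>(z - x)^n\<close>, \<open>Im x < 0\<close>. By the Hermite-Biehler argument \<open>T (z - x)^n\<close> has no zero in the upper half-plane
  for large \<open>n\<close>; up to a nonvanishing factor, with \<open>x = n/w\<close> it tends to \<open>P(z, w)\<close>, and Hurwitz' theorem
  applies. Conversely, for fixed \<open>z\<close> in the upper half-plane, \<open>F(z, D)\<close> is a product of factors \<open>D - r\<close> with
  \<open>Im r \<ge> 0\<close>, and each of them preserves the absence of zeros in the upper half-plane.

  Stability of \<open>P\<close> passes to its homogenization \<open>G\<close> for every real \<open>y\<close> (for \<open>y = 0\<close> by Hurwitz' theorem),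
  which gives (i) and (ii). Conversely, (ii) puts every \<open>(0, a, b)\<close> with \<open>a, b > 0\<close> in the hyperbolicity cone of
  \<open>(0, 1, 1)\<close>, and Garding's homotopy argument shows that \<open>G\<close> is hyperbolic with respect to all of them.
\<close>

subsection \<open>Limits of zero-free functions\<close>

text \<open>Joint continuity makes \<open>H (e n)\<close> converge to \<open>H e0\<close> uniformly
  on compact sets, so Hurwitz' theorem applies to a nonconstant limit. The point \<open>z1\<close>
  settles the constant case and excludes the zero limit.\<close>

lemma hurwitz_param:
  fixes H :: "real \<Rightarrow> complex \<Rightarrow> complex"
  assumes S: "open S" "connected S"
    and cont: "continuous_on UNIV (\<lambda>(e, z). H e z)"
    and hol: "\<And>e. H e holomorphic_on S"
    and lim: "e \<longlonglongrightarrow> e0"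
    and nz: "\<And>n z. z \<in> S \<Longrightarrow> H (e n) z \<noteq> 0"
    and ex: "z1 \<in> S" "H e0 z1 \<noteq> 0"
    and z: "z \<in> S"
  shows "H e0 z \<noteq> 0"
proof (cases "H e0 constant_on S")
  case True
  with ex z show ?thesis by (auto simp: constant_on_def)
next
  case False
  have ul: "uniform_limit K (\<lambda>n. H (e n)) (H e0) sequentially" if K: "compact K" for K
  proof (rule uniform_limitI)
    fix r :: real assume r: "r > 0"
    have c: "continuous_on (UNIV \<times> K) (\<lambda>(e, z). H e z)"
      using cont continuous_on_subset by blast
    obtain X where X: "e0 \<in> X" "open X"
      "\<And>x t. x \<in> X \<inter> UNIV \<Longrightarrow> t \<in> K \<Longrightarrow> dist (case (x, t) of (e, z) \<Rightarrow> H e z) (case (e0, t) of (e, z) \<Rightarrow> H e z) \<le> r / 2"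
      using continuous_on_prod_compactE[OF c K, of e0 "r / 2"] r by (metis UNIV_I half_gt_zero)
    have "\<forall>\<^sub>F n in sequentially. e n \<in> X"
      using lim X by (simp add: topological_tendstoD)
    then show "\<forall>\<^sub>F n in sequentially. \<forall>t\<in>K. dist (H (e n) t) (H e0 t) < r"
      by eventually_elim (use X r in force)
  qed
  show ?thesis
    by (rule Hurwitz_no_zeros[of S "\<lambda>n. H (e n)"])
       (use S hol ul False nz z in auto)
qed

lemma open_upper_half: "open {z. Im z > 0}" and connected_upper_half: "connected {z. Im z > 0}"
  by (auto simp: open_halfspace_Im_gt convex_halfspace_Im_gt intro!: convex_connected)

text \<open>By continuity, nonvanishing at a real point persists when both arguments are shifted
  slightly upwards. This supplies the anchor for Hurwitz' theorem in two variables.\<close>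

lemma upper_half_point:
  fixes K :: "complex \<Rightarrow> complex \<Rightarrow> complex"
  assumes cont: "continuous_on UNIV (\<lambda>(z, w). K z w)"
    and nz: "K (of_real x) (of_real y) \<noteq> 0"
  shows "\<exists>z w. Im z > 0 \<and> Im w > 0 \<and> K z w \<noteq> 0"
proof -
  define g where "g s = K (Complex x s) (Complex y s)" for s
  have "continuous_on UNIV g"
  proof -
    have "continuous_on UNIV ((\<lambda>(z, w). K z w) \<circ> (\<lambda>s. (of_real x + \<i> * of_real s, of_real y + \<i> * of_real s)))"
      by (intro continuous_on_compose continuous_intros continuous_on_subset[OF cont]) auto
    then show ?thesis
      by (simp add: g_def[abs_def] o_def Complex_eq)
  qed
  then have "g \<midarrow>0\<rightarrow> g 0"
    by (simp add: continuous_on_eq_continuous_within isContD)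
  moreover have "g 0 \<noteq> 0"
    using nz by (simp add: g_def complex_of_real_def)
  ultimately have "\<forall>\<^sub>F s in at 0. g s \<noteq> 0"
    using tendsto_imp_eventually_ne by blast
  then obtain d where d: "d > 0" "\<And>s. s \<noteq> 0 \<Longrightarrow> dist s 0 < d \<Longrightarrow> g s \<noteq> 0"
    by (auto simp: eventually_at)
  have "g (d / 2) \<noteq> 0"
    using d by (intro d(2)) auto
  then show ?thesis
    using d(1) by (intro exI[of _ "Complex x (d/2)"] exI[of _ "Complex y (d/2)"]) (simp add: g_def)
qed

text \<open>Apply the one-variable theorem on the complex line that passes through
  \<open>(z, w)\<close> at \<open>t = 0\<close> and through an anchor \<open>(z1, w1)\<close> at
  \<open>t = 1\<close>. The parameters for which both coordinates stay in the upper half-plane form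
  a convex set.\<close>

lemma hurwitz_two:
  fixes H :: "real \<Rightarrow> complex \<Rightarrow> complex \<Rightarrow> complex"
  assumes cont: "continuous_on UNIV (\<lambda>(e, z, w). H e z w)"
    and hol: "\<And>e z w a b. (\<lambda>t. H e (z + t * a) (w + t * b)) holomorphic_on UNIV"
    and lim: "e \<longlonglongrightarrow> e0"
    and nz: "\<And>n z w. Im z > 0 \<Longrightarrow> Im w > 0 \<Longrightarrow> H (e n) z w \<noteq> 0"
    and ex: "H e0 (of_real x) (of_real y) \<noteq> 0"
    and zw: "Im z > 0" "Im w > 0"
  shows "H e0 z w \<noteq> 0"
proof -
  have "continuous_on UNIV (\<lambda>(z, w). H e0 z w)"
  proof -
    have "continuous_on UNIV ((\<lambda>(e, z, w). H e z w) \<circ> (\<lambda>p. (e0, p)))"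
      by (intro continuous_on_compose continuous_intros continuous_on_subset[OF cont]) auto
    then show ?thesis by (simp add: o_def)
  qed
  from upper_half_point[OF this ex] obtain z1 w1
    where 1: "Im z1 > 0" "Im w1 > 0" "H e0 z1 w1 \<noteq> 0" by blast
  define S where "S = {t. Im (z + t * (z1 - z)) > 0} \<inter> {t. Im (w + t * (w1 - w)) > 0}"
  have half: "open {t. Im (p + t * q) > 0}" "convex {t. Im (p + t * q) > 0}" for p q
  proof -
    show "open {t. Im (p + t * q) > 0}"
      by (intro open_Collect_less continuous_intros)
    \<comment> \<open>\<open>Im (t * q)\<close> is the real inner product of \<open>t\<close> with
      \<open>Complex (Im q) (Re q)\<close>.\<close>
    have "{t. Im (p + t * q) > 0} = {t. inner (Complex (Im q) (Re q)) t > - Im p}"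
      by (auto simp: inner_complex_def algebra_simps)
    then show "convex {t. Im (p + t * q) > 0}"
      by (simp only: convex_halfspace_gt)
  qed
  have S: "open S" "connected S"
    unfolding S_def by (intro open_Int half, intro convex_connected convex_Int half)
  have "H e0 (z + 0 * (z1 - z)) (w + 0 * (w1 - w)) \<noteq> 0"
  proof (rule hurwitz_param[of S "\<lambda>e t. H e (z + t * (z1 - z)) (w + t * (w1 - w))" e e0 1 0, OF S _ _ lim])
    have "continuous_on UNIV ((\<lambda>(e, z, w). H e z w) \<circ> (\<lambda>p. (fst p, z + snd p * (z1 - z), w + snd p * (w1 - w))))"
      by (intro continuous_on_compose continuous_intros continuous_on_subset[OF cont]) auto
    then show "continuous_on UNIV (\<lambda>(e, t). H e (z + t * (z1 - z)) (w + t * (w1 - w)))"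
      by (simp add: o_def case_prod_unfold)
    show "(\<lambda>t. H e (z + t * (z1 - z)) (w + t * (w1 - w))) holomorphic_on S" for e
      by (rule holomorphic_on_subset[OF hol]) simp
  qed (use nz zw 1 in \<open>auto simp: S_def\<close>)
  then show ?thesis by simp
qed

subsection \<open>Stable symbols give preservers\<close>

abbreviation cpoly :: "real poly \<Rightarrow> complex poly" where
  "cpoly \<equiv> map_poly complex_of_real"

lemma cpoly_add: "cpoly (p + q) = cpoly p + cpoly q"
  by (simp add: poly_eq_iff coeff_map_poly)

lemma cpoly_smult: "cpoly (smult c p) = smult (of_real c) (cpoly p)"
  by (simp add: poly_eq_iff coeff_map_poly)

lemma cpoly_sum: "cpoly (sum f A) = (\<Sum>x\<in>A. cpoly (f x))"
  by (simp add: poly_eq_iff coeff_map_poly coeff_sum)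

lemma cpoly_mult: "cpoly (p * q) = cpoly p * cpoly q"
  by (simp add: poly_eq_iff coeff_map_poly coeff_mult)

lemma cpoly_monom: "cpoly (monom a n) = monom (of_real a) n"
  by (simp add: poly_eq_iff coeff_map_poly)

lemma cpoly_pderiv: "cpoly (pderiv p) = pderiv (cpoly p)"
  by (simp add: poly_eq_iff coeff_map_poly coeff_pderiv)

lemma cpoly_higher_pderiv: "cpoly ((pderiv ^^ k) p) = (pderiv ^^ k) (cpoly p)"
  by (induction k) (simp_all add: cpoly_pderiv)

lemma cpoly_power: "cpoly (p ^ n) = cpoly p ^ n"
  by (induction n) (simp_all add: cpoly_mult)

lemma cpoly_eq_0_iff: "cpoly p = 0 \<longleftrightarrow> p = 0"
  by (simp add: map_poly_eq_0_iff)

lemma cpoly_eq_iff: "cpoly p = cpoly q \<longleftrightarrow> p = q"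
  by (auto simp: poly_eq_iff coeff_map_poly)

lemma degree_cpoly: "degree (cpoly p) = degree p"
  by (rule degree_map_poly) simp

lemma poly_cpoly_cnj: "poly (cpoly p) (cnj z) = cnj (poly (cpoly p) z)"
  by (induction p) (simp_all add: map_poly_pCons)

text \<open>Zeros of a real polynomial come in conjugate pairs, so excluding the upper half-plane
  excludes all nonreal zeros.\<close>

lemma only_real_zeros_iff: "only_real_zeros p \<longleftrightarrow> (\<forall>z. Im z > 0 \<longrightarrow> poly (cpoly p) z \<noteq> 0)"
proof
  assume "only_real_zeros p"
  then show "\<forall>z. Im z > 0 \<longrightarrow> poly (cpoly p) z \<noteq> 0"
    by (auto simp: only_real_zeros_def complex_zeros_def complex_is_Real_iff)
next
  assume *: "\<forall>z. Im z > 0 \<longrightarrow> poly (cpoly p) z \<noteq> 0"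
  have "Im z = 0" if z: "poly (cpoly p) z = 0" for z
  proof -
    have "poly (cpoly p) (cnj z) = 0"
      by (simp add: poly_cpoly_cnj z)
    with * z have "\<not> Im z > 0" "\<not> Im (cnj z) > 0"
      by blast+
    then show ?thesis by simp
  qed
  then show "only_real_zeros p"
    by (auto simp: only_real_zeros_def complex_zeros_def complex_is_Real_iff)
qed

definition cdiff_op :: "2 mpoly \<Rightarrow> complex poly \<Rightarrow> complex poly" where
  "cdiff_op F f =
     (\<Sum>m\<in>Poly_Mapping.keys F.
        monom (of_real (Poly_Mapping.lookup F m)) (Poly_Mapping.lookup m 1) *
        (pderiv ^^ Poly_Mapping.lookup m 2) f)"

lemma cdiff_op_cpoly: "cdiff_op F (cpoly f) = cpoly (diff_op F f)"
  by (simp add: cdiff_op_def diff_op_def cpoly_sum cpoly_mult cpoly_monom cpoly_higher_pderiv)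

lemma cdiff_op_add: "cdiff_op F (f + g) = cdiff_op F f + cdiff_op F g"
  by (simp add: cdiff_op_def higher_pderiv_add algebra_simps sum.distrib)

lemma smult_sum_right: "smult c (sum g A) = (\<Sum>x\<in>A. smult c (g x))"
  by (induction A rule: infinite_finite_induct) (simp_all add: smult_add_right)

lemma higher_pderiv_diff:
  fixes f g :: "'a::idom poly"
  shows "(pderiv ^^ k) (f - g) = (pderiv ^^ k) f - (pderiv ^^ k) g"
  by (induction k) (simp_all add: pderiv_diff)

lemma cdiff_op_smult: "cdiff_op F (smult c f) = smult c (cdiff_op F f)"
  by (simp add: cdiff_op_def higher_pderiv_smult smult_sum_right)

lemma cdiff_op_0 [simp]: "cdiff_op F 0 = 0"
  by (simp add: cdiff_op_def)

lemma cdiff_op_sum: "cdiff_op F (sum f A) = (\<Sum>x\<in>A. cdiff_op F (f x))"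
  by (induction A rule: infinite_finite_induct) (simp_all add: cdiff_op_add)

abbreviation ceval :: "'n::finite mpoly \<Rightarrow> complex ^ 'n \<Rightarrow> complex" where
  "ceval \<equiv> msubst complex_of_real"

lemma ceval_2: "ceval F (vector [z, w]) =
   (\<Sum>m\<in>Poly_Mapping.keys F. of_real (Poly_Mapping.lookup F m) *
      (z ^ Poly_Mapping.lookup m 1 * w ^ Poly_Mapping.lookup m (2::2)))"
  by (simp add: msubst_def prod_UNIV_2)

definition stable_symbol :: "2 mpoly \<Rightarrow> bool" where
  "stable_symbol F \<longleftrightarrow> (\<forall>z w. Im z > 0 \<longrightarrow> Im w > 0 \<longrightarrow> ceval F (vector [z, - w]) \<noteq> 0)"

section \<open>Logarithmic derivatives and constant-coefficient operators\<close>

text \<open>\<open>f'/f\<close> is the sum of \<open>1 / (z - r)\<close> over the roots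
  \<open>r\<close> with multiplicity. Each root has \<open>Im r \<le> 0 < Im z\<close>, so every
  summand has negative imaginary part. The induction splits off one root at a time.\<close>

lemma log_deriv_Im_neg:
  fixes f :: "complex poly"
  assumes "degree f > 0" "\<And>z. Im z > 0 \<Longrightarrow> poly f z \<noteq> 0" "Im z > 0"
  shows "Im (poly (pderiv f) z / poly f z) < 0"
  using assms
proof (induction "degree f" arbitrary: f)
  case (Suc n)
  obtain r where r: "poly f r = 0"
    using alg_closed_imp_poly_has_root[of f] Suc by auto
  then obtain g where g: "f = [:-r, 1:] * g"
    by (auto simp: poly_eq_0_iff_dvd elim: dvdE)
  have [simp]: "g \<noteq> 0"
    using Suc.prems g by auto
  have "degree f = Suc (degree g)"
    unfolding g by (subst degree_mult_eq) auto
  with Suc have n: "n = degree g" by simp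
  have r': "Im r \<le> 0"
    using Suc.prems(2)[of r] r by fastforce
  have gnz: "poly g z \<noteq> 0" if "Im z > 0" for z
    using Suc.prems(2)[OF that] by (simp add: g)
  have zr: "z - r \<noteq> 0"
    using r' Suc.prems(3) by auto
  have eq: "poly (pderiv f) z / poly f z = 1 / (z - r) + poly (pderiv g) z / poly g z"
  proof -
    have "poly (pderiv f) z = poly g z + (z - r) * poly (pderiv g) z"
      unfolding g pderiv_mult by (simp add: pderiv_pCons algebra_simps)
    then show ?thesis
      using gnz[OF Suc.prems(3)] zr by (simp add: g field_simps)
  qed
  have 1: "Im (1 / (z - r)) < 0"
    using r' Suc.prems(3) by (auto simp: Im_divide_Reals Im_complex_div_lt_0 Im_divide power2_eq_square intro!: divide_neg_pos sum_squares_gt_zero_iff[THEN iffD2])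
  have 2: "Im (poly (pderiv g) z / poly g z) \<le> 0"
  proof (cases "degree g = 0")
    case True
    then show ?thesis by (simp add: pderiv_eq_0_iff[THEN iffD2])
  next
    case False
    then show ?thesis using Suc.hyps(1)[OF n] gnz Suc.prems(3) by fastforce
  qed
  show ?case using 1 2 by (simp add: eq)
qed simp

text \<open>The constant-coefficient operator \<open>h(D)\<close>, where \<open>D\<close> is
  differentiation.\<close>

definition opD :: "complex poly \<Rightarrow> complex poly \<Rightarrow> complex poly" where
  "opD h f = (\<Sum>k\<le>degree h. smult (coeff h k) ((pderiv ^^ k) f))"

lemma opD_upto:
  assumes "degree h \<le> N"
  shows "opD h f = (\<Sum>k\<le>N. smult (coeff h k) ((pderiv ^^ k) f))"
  unfolding opD_def
  by (rule sum.mono_neutral_left) (use assms in \<open>auto simp: coeff_eq_0\<close>)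

lemma opD_add: "opD (g + h) f = opD g f + opD h f"
proof -
  define N where "N = max (degree g) (degree h)"
  show ?thesis
    by (subst (1 2 3) opD_upto[of _ N])
       (auto simp: N_def degree_add_le smult_add_left sum.distrib)
qed

lemma opD_0 [simp]: "opD 0 f = 0"
  by (simp add: opD_def)

lemma opD_sum: "opD (sum h A) f = (\<Sum>x\<in>A. opD (h x) f)"
  by (induction A rule: infinite_finite_induct) (simp_all add: opD_add)

lemma opD_monom: "opD (monom c k) f = smult c ((pderiv ^^ k) f)"
proof -
  have "opD (monom c k) f = (\<Sum>i\<le>k. if i = k then smult c ((pderiv ^^ k) f) else 0)"
    unfolding opD_upto[OF degree_monom_le] by (rule sum.cong) auto
  then show ?thesis by simp
qed

lemma opD_smult: "opD (smult c h) f = smult c (opD h f)"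
  by (simp add: opD_upto[OF degree_smult_le] opD_def smult_sum_right)

text \<open>The factor \<open>D - r\<close> is applied first, so a factorization of \<open>h\<close>
  can be worked off from the inside.\<close>

lemma opD_linear_mult: "opD ([:-r, 1:] * h) f = opD h (pderiv f - smult r f)"
proof -
  have "opD ([:-r, 1:] * h) f = opD (smult (-r) h) f + opD (pCons 0 h) f"
    by (simp add: opD_add[symmetric])
  also have "opD (pCons 0 h) f = opD h (pderiv f)"
    unfolding opD_upto[OF degree_pCons_le]
    by (subst sum.atMost_Suc_shift)
       (simp add: opD_def funpow_swap1)
  also have "opD (smult (-r) h) f + opD h (pderiv f) = opD h (pderiv f - smult r f)"
    by (simp add: opD_smult)
       (simp add: opD_def higher_pderiv_smult higher_pderiv_diff smult_diff_right sum_subtractf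
         smult_sum_right mult.commute sum_negf)
  finally show ?thesis .
qed

text \<open>For \<open>r\<close> in the closed upper half-plane, \<open>f' - r f = f (f'/f - r)\<close> has no zero in the open upper
  half-plane; the degree drops by at most one with each factor, so no intermediate polynomial is constant.\<close>

lemma opD_nonzero:
  assumes "h \<noteq> 0" "\<And>r. poly h r = 0 \<Longrightarrow> Im r \<ge> 0"
    and "degree f \<ge> degree h" "\<And>z. Im z > 0 \<Longrightarrow> poly f z \<noteq> 0" "Im z > 0"
  shows "poly (opD h f) z \<noteq> 0"
  using assms
proof (induction "degree h" arbitrary: h f)
  case 0
  then obtain c where "h = [:c:]" "c \<noteq> 0"
    by (metis degree_eq_zeroE pCons_eq_0_iff)
  then show ?case using 0 by (simp add: opD_def)
next
  case (Suc n)
  obtain r where r: "poly h r = 0"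
    using alg_closed_imp_poly_has_root[of h] Suc by auto
  then obtain g where g: "h = [:-r, 1:] * g"
    by (auto simp: poly_eq_0_iff_dvd elim: dvdE)
  have [simp]: "g \<noteq> 0"
    using Suc.prems g by auto
  have deg: "degree h = Suc (degree g)"
    unfolding g by (subst degree_mult_eq) auto
  with Suc have n: "n = degree g" by simp
  have r': "Im r \<ge> 0"
    using Suc.prems r by blast
  let ?f = "pderiv f - smult r f"
  have "degree f > 0"
    using Suc deg by simp
  \<comment> \<open>For \<open>r = 0\<close> the degree drops by one; otherwise the leading term of
    \<open>r f\<close> survives.\<close>
  have "degree ?f \<ge> degree f - 1"
  proof (cases "r = 0")
    case True
    then show ?thesis by (simp add: degree_pderiv)
  next
    case False
    have "degree (pderiv f) < degree (smult (-r) f)"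
      using \<open>degree f > 0\<close> False by (simp add: degree_pderiv)
    from degree_add_eq_right[OF this] show ?thesis
      using False by simp
  qed
  moreover have "poly ?f z \<noteq> 0" if z: "Im z > 0" for z
  proof
    assume "poly ?f z = 0"
    then have "poly (pderiv f) z / poly f z = r"
      using Suc.prems(4)[OF z] by (simp add: field_simps)
    then show False
      using log_deriv_Im_neg[OF \<open>degree f > 0\<close> Suc.prems(4) z] r' by simp
  qed
  ultimately have "poly (opD g ?f) z \<noteq> 0"
    using Suc.prems deg by (intro Suc.hyps(1)[OF n]) (auto simp: g)
  then show ?case
    unfolding g opD_linear_mult .
qed

text \<open>Freezing \<open>z\<close> in the coefficients turns \<open>T\<close> into the
  constant-coefficient operator with symbol \<open>F(z, .)\<close>. The results agree when evaluated
  at that same \<open>z\<close>, though in general not as polynomials.\<close>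

lemma poly_cdiff_op_eq_opD:
  "poly (cdiff_op F f) z =
   poly (opD (\<Sum>m\<in>Poly_Mapping.keys F. monom (of_real (Poly_Mapping.lookup F m) * z ^ Poly_Mapping.lookup m 1)
      (Poly_Mapping.lookup m 2)) f) z"
  by (simp add: cdiff_op_def opD_sum opD_monom poly_sum poly_monom mult.assoc)

lemma only_real_zeros_mult:
  assumes "only_real_zeros p" "only_real_zeros q"
  shows "only_real_zeros (p * q)"
  using assms by (simp add: only_real_zeros_iff cpoly_mult)

text \<open>\<open>opD_nonzero\<close> needs a polynomial whose degree is at least the order of the
  operator. Multiplying \<open>f\<close> by \<open>(1 + e z)^N\<close> achieves this for
  \<open>e \<noteq> 0\<close> and keeps all zeros real; Hurwitz' theorem for \<open>e\<close>
  tending to 0 returns to \<open>f\<close>.\<close>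

lemma stable_imp_real_rooted:
  assumes st: "stable_symbol F" and f: "f \<in> real_rooted"
  shows "diff_op F f \<in> real_rooted \<union> {0}"
proof (cases "diff_op F f = 0")
  case False
  define N where "N = Max (insert 0 ((\<lambda>m. Poly_Mapping.lookup m 2) ` Poly_Mapping.keys F))"
  have N: "Poly_Mapping.lookup m 2 \<le> N" if "m \<in> Poly_Mapping.keys F" for m
    using that by (simp add: N_def)
  define g where "g e = cpoly (f * [:1, e:] ^ N)" for e :: real
  define H where "H e z = poly (cdiff_op F (g e)) z" for e z
  have [simp]: "f \<noteq> 0" using f by (simp add: real_rooted_def)
  have lin: "only_real_zeros [:1, e:]" for e
    unfolding only_real_zeros_iff
  proof (intro allI impI notI)
    fix z assume "Im z > 0" "poly (cpoly [:1, e:]) z = 0"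
    then have "1 + z * of_real e = 0" by (simp add: map_poly_pCons)
    then have "Im (1 + z * of_real e) = 0" "Re (1 + z * of_real e) = 0" by simp_all
    then show False using \<open>Im z > 0\<close> by auto
  qed
  have "only_real_zeros (f * [:1, e:] ^ n)" for e n
  proof (induction n)
    case 0
    then show ?case using f by (simp add: real_rooted_def)
  next
    case (Suc n)
    then show ?case
      using only_real_zeros_mult[OF Suc lin[of e]] by (simp add: mult_ac)
  qed
  then have gnz: "poly (g e) z \<noteq> 0" if "Im z > 0" for e z
    using that unfolding g_def only_real_zeros_iff by blast
  have degg: "degree (g e) \<ge> N" if "e \<noteq> 0" for e
    using that unfolding g_def degree_cpoly by (subst degree_mult_eq) (auto simp: degree_power_eq)
  have nz: "H e z \<noteq> 0" if e: "e \<noteq> 0" and z: "Im z > 0" for e z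
  proof -
    define h where "h = (\<Sum>m\<in>Poly_Mapping.keys F. monom (complex_of_real (Poly_Mapping.lookup F m) *
       z ^ Poly_Mapping.lookup m 1) (Poly_Mapping.lookup m 2))"
    have h: "poly h w = ceval F (vector [z, w])" for w
      by (simp add: h_def ceval_2 poly_sum poly_monom mult.assoc)
    \<comment> \<open>Stability at \<open>w = i\<close> gives \<open>h(-i) \<noteq> 0\<close>. A
      root \<open>r\<close> of \<open>h\<close> with \<open>Im r < 0\<close> would contradict
      stability at \<open>w = -r\<close>.\<close>
    have "h \<noteq> 0"
      using st z h[of "-\<i>"] by (auto simp: stable_symbol_def)
    moreover have "Im r \<ge> 0" if "poly h r = 0" for r
    proof (rule ccontr)
      assume "\<not> Im r \<ge> 0"
      then have "ceval F (vector [z, - (- r)]) \<noteq> 0"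
        using st z unfolding stable_symbol_def by (metis minus_complex.sel(2) neg_0_less_iff_less not_le uminus_complex.sel(2))
      with that h show False by simp
    qed
    moreover have "degree h \<le> N"
      unfolding h_def by (rule degree_sum_le) (auto intro: order.trans[OF degree_monom_le] N)
    ultimately have "poly (opD h (g e)) z \<noteq> 0"
      using gnz z degg[OF e] by (intro opD_nonzero) auto
    then show ?thesis
      by (simp add: H_def poly_cdiff_op_eq_opD h_def)
  qed
  \<comment> \<open>The binomial expansion shows that \<open>H\<close> is polynomial in
    \<open>e\<close> and \<open>z\<close>, hence jointly continuous.\<close>
  have H_eq: "H e z = (\<Sum>l\<le>N. of_nat (N choose l) * of_real e ^ l * poly (cdiff_op F (cpoly (f * monom 1 l))) z)" for e z
  proof -
    have "[:1, e:] = monom e 1 + 1"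
      by (simp add: monom_altdef one_pCons)
    then have "[:1, e:] ^ N = (\<Sum>l\<le>N. of_nat (N choose l) * monom e 1 ^ l * 1 ^ (N - l))"
      by (simp only: binomial_ring)
    also have "\<dots> = (\<Sum>l\<le>N. smult (of_nat (N choose l) * e ^ l) (monom 1 l))"
      by (simp add: monom_power smult_monom of_nat_poly)
    finally have "g e = (\<Sum>l\<le>N. smult (of_nat (N choose l) * of_real e ^ l) (cpoly (f * monom 1 l)))"
      by (simp add: g_def sum_distrib_left cpoly_sum cpoly_smult)
    then show ?thesis
      by (simp add: H_def cdiff_op_sum cdiff_op_smult poly_sum)
  qed
  have H0: "H 0 z = poly (cpoly (diff_op F f)) z" for z
    by (simp add: H_def g_def cdiff_op_cpoly flip: one_pCons)
  \<comment> \<open>A nonzero polynomial has finitely many roots, so it cannot vanish on the whole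
    half-plane. This is the anchor for Hurwitz' theorem.\<close>
  have "\<exists>z. Im z > 0 \<and> poly (cpoly (diff_op F f)) z \<noteq> 0"
  proof (rule ccontr)
    assume "\<not> ?thesis"
    then have "{z. Im z > 0} \<subseteq> {z. poly (cpoly (diff_op F f)) z = 0}" by auto
    moreover have "finite {z. poly (cpoly (diff_op F f)) z = 0}"
      using False by (intro poly_roots_finite) (simp add: cpoly_eq_0_iff)
    ultimately have "finite {z. Im z > 0}"
      by (rule finite_subset)
    moreover have "\<i> \<in> {z. Im z > 0}" by simp
    ultimately show False
      using finite_imp_not_open[of "{z. Im z > 0}"] open_upper_half by blast
  qed
  then obtain z1 where z1: "Im z1 > 0" "H 0 z1 \<noteq> 0"
    by (auto simp: H0)
  have "H 0 z \<noteq> 0" if "Im z > 0" for z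
  proof (rule hurwitz_param[of "{z. Im z > 0}" H "\<lambda>n. 1 / real (Suc n)" 0 z1, OF open_upper_half connected_upper_half])
    show "continuous_on UNIV (\<lambda>(e, z). H e z)"
      unfolding H_eq case_prod_unfold by (intro continuous_intros)
    show "H e holomorphic_on {z. 0 < Im z}" for e
      unfolding H_def by (intro holomorphic_intros)
    show "(\<lambda>n. 1 / real (Suc n)) \<longlonglongrightarrow> 0"
      using LIMSEQ_inverse_real_of_nat by (simp add: inverse_eq_divide)
  qed (use nz z1 that in auto)
  then show ?thesis
    using False by (auto simp: real_rooted_def only_real_zeros_iff H0)
qed simp

subsection \<open>Preservers have stable symbols\<close>

text \<open>The quotient \<open>\<phi> = V / U\<close> takes no real value in the upper half-plane,
  since such a value would give a zero of a real combination of \<open>U\<close> and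
  \<open>V\<close>. Near infinity it behaves like \<open>c / z\<close> with \<open>c > 0\<close>, so
  \<open>Im \<phi>\<close> is negative far up the imaginary axis, hence everywhere by connectedness.
  A zero of \<open>U + i V\<close> would mean \<open>\<phi> = i\<close>.\<close>

lemma hermite_biehler:
  fixes U V :: "real poly"
  assumes V: "V \<noteq> 0" and deg: "degree U = Suc (degree V)"
    and lc: "lead_coeff U * lead_coeff V > 0"
    and comb: "\<And>a b. a \<noteq> 0 \<or> b \<noteq> 0 \<Longrightarrow> only_real_zeros (smult a U + smult b V)"
    and z: "Im z > 0"
  shows "poly (cpoly U) z + \<i> * poly (cpoly V) z \<noteq> 0"
proof
  assume z0: "poly (cpoly U) z + \<i> * poly (cpoly V) z = 0"
  define S where "S = {z. Im z > 0}"
  define \<phi> where "\<phi> z = poly (cpoly V) z / poly (cpoly U) z" for z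
  have Unz: "poly (cpoly U) z \<noteq> 0" if "Im z > 0" for z
    using comb[of 1 0] that by (simp add: only_real_zeros_iff)
  have Imnz: "Im (\<phi> z) \<noteq> 0" if z: "Im z > 0" for z
  proof
    assume "Im (\<phi> z) = 0"
    then have "\<phi> z = of_real (Re (\<phi> z))"
      by (simp add: complex_eq_iff)
    then have "poly (cpoly V) z = of_real (Re (\<phi> z)) * poly (cpoly U) z"
      using Unz[OF z] by (simp add: \<phi>_def nonzero_divide_eq_eq)
    then have "poly (cpoly (smult (- Re (\<phi> z)) U + smult 1 V)) z = 0"
      unfolding cpoly_add cpoly_smult by simp
    with comb[OF disjI2[OF one_neq_zero], of "- Re (\<phi> z)"] z show False
      unfolding only_real_zeros_iff by blast
  qed
  have "\<exists>z\<in>S. Im (\<phi> z) < 0"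
  proof -
    define c where "c = lead_coeff V / lead_coeff U"
    have c: "c > 0"
      using lc by (auto simp: c_def zero_less_mult_iff divide_neg_neg)
    have "((\<lambda>z. (poly (cpoly V) z / z ^ degree V) / (poly (cpoly U) z / z ^ degree U)) \<longlongrightarrow>
       lead_coeff (cpoly V) / lead_coeff (cpoly U)) at_infinity"
      using poly_divide_tendsto_aux[of "cpoly V"] poly_divide_tendsto_aux[of "cpoly U"] lc
      by (intro tendsto_divide) (auto simp: degree_cpoly coeff_map_poly)
    also have "lead_coeff (cpoly V) / lead_coeff (cpoly U) = of_real c"
      by (simp add: c_def degree_cpoly coeff_map_poly)
    finally have "((\<lambda>z. Re ((poly (cpoly V) z / z ^ degree V) / (poly (cpoly U) z / z ^ degree U))) \<longlongrightarrow>
       Re (of_real c)) at_infinity"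
      by (intro tendsto_Re)
    then have "\<forall>\<^sub>F z in at_infinity. Re ((poly (cpoly V) z / z ^ degree V) / (poly (cpoly U) z / z ^ degree U)) > 0"
      using c by (auto elim: order_tendstoD)
    then obtain b where b: "\<And>z. norm z \<ge> b \<Longrightarrow>
       Re ((poly (cpoly V) z / z ^ degree V) / (poly (cpoly U) z / z ^ degree U)) > 0"
      by (auto simp: eventually_at_infinity)
    define y where "y = max b 1"
    have y: "y > 0" "norm (\<i> * of_real y) \<ge> b"
      by (auto simp: y_def norm_mult)
    have "(poly (cpoly V) (\<i> * of_real y) / (\<i> * of_real y) ^ degree V) /
       (poly (cpoly U) (\<i> * of_real y) / (\<i> * of_real y) ^ degree U) = \<i> * of_real y * \<phi> (\<i> * of_real y)"
      using y(1) by (simp add: \<phi>_def deg)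
    with b[OF y(2)] have "- y * Im (\<phi> (\<i> * of_real y)) > 0"
      by simp
    then have "Im (\<phi> (\<i> * of_real y)) < 0"
      using y(1) by (simp add: mult_less_0_iff)
    then show ?thesis
      using y(1) by (intro bexI[of _ "\<i> * of_real y"]) (auto simp: S_def)
  qed
  moreover have "\<phi> z = \<i>"
  proof -
    have "poly (cpoly V) z = \<i> * poly (cpoly U) z"
      using z0 by (simp add: add_eq_0_iff2 algebra_simps)
    then show ?thesis using Unz[OF z] by (simp add: \<phi>_def)
  qed
  ultimately obtain z' where z': "z' \<in> S" "Im (\<phi> z') < 0" "Im (\<phi> z) > 0"
    by auto
  have "connected ((\<lambda>z. Im (\<phi> z)) ` S)"
  proof (rule connected_continuous_image)
    show "connected S"
      unfolding S_def by (intro convex_connected convex_halfspace_Im_gt)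
    show "continuous_on S (\<lambda>z. Im (\<phi> z))"
      unfolding \<phi>_def by (intro continuous_intros) (use Unz in \<open>auto simp: S_def\<close>)
  qed
  moreover have "Im (\<phi> z') \<in> (\<lambda>z. Im (\<phi> z)) ` S" "Im (\<phi> z) \<in> (\<lambda>z. Im (\<phi> z)) ` S"
    using z'(1) z by (simp_all add: S_def)
  ultimately have "0 \<in> (\<lambda>z. Im (\<phi> z)) ` S"
    using z'(2,3) by (meson connectedD_interval less_imp_le)
  then obtain y where "y \<in> S" "Im (\<phi> y) = 0" by force
  then show False
    using Imnz[of y] by (simp add: S_def)
qed

text \<open>If \<open>a P + b Q = 0\<close>, then \<open>(P, Q)\<close> is a complex multiple of the
  real vector \<open>(b, -a)\<close>, so \<open>P + i Q\<close> and \<open>P - i Q\<close> have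
  equal modulus. These are \<open>(z - x)^n\<close> and \<open>(z - cnj x)^n\<close>, but
  \<open>z\<close> is strictly closer to \<open>cnj x\<close> than to \<open>x\<close>.\<close>

lemma linear_power_real_combination:
  fixes p q :: "real poly"
  assumes f: "[:-x, 1:] ^ n = cpoly p + smult \<i> (cpoly q)" and n: "n > 0" and x: "Im x < 0"
    and ab: "a \<noteq> 0 \<or> b \<noteq> 0"
  shows "only_real_zeros (smult a p + smult b q)"
  unfolding only_real_zeros_iff
proof (intro allI impI notI)
  fix z assume z: "Im z > 0" and "poly (cpoly (smult a p + smult b q)) z = 0"
  define P where "P = poly (cpoly p) z"
  define Q where "Q = poly (cpoly q) z"
  have 0: "of_real a * P + of_real b * Q = 0"
    using \<open>poly _ z = 0\<close> by (simp add: P_def Q_def cpoly_add cpoly_smult)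
  have 1: "(z - x) ^ n = P + \<i> * Q"
    using arg_cong[OF f, of "\<lambda>f. poly f z"] by (simp add: P_def Q_def poly_power)
  have "cnj ((cnj z - x) ^ n) = cnj (poly (cpoly p) (cnj z) + \<i> * poly (cpoly q) (cnj z))"
    using arg_cong[OF f, of "\<lambda>f. poly f (cnj z)"] by (simp add: poly_power)
  then have 2: "(z - cnj x) ^ n = P - \<i> * Q"
    by (simp add: P_def Q_def poly_cpoly_cnj)
  obtain s where s: "P = of_real b * s" "Q = - of_real a * s"
  proof (cases "b = 0")
    case True
    then show ?thesis using that[of "- Q / of_real a"] 0 ab by simp
  next
    case False
    then have "Q = - of_real a * (P / of_real b)"
      using 0 by (simp add: field_simps add_eq_0_iff)
    then show ?thesis using that[of "P / of_real b"] False by simp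
  qed
  have "P + \<i> * Q = s * Complex b (- a)" "P - \<i> * Q = s * Complex b a"
    by (simp_all add: s Complex_eq algebra_simps)
  moreover have "norm (Complex b (- a)) = norm (Complex b a)"
    by (simp add: cmod_def)
  ultimately have "norm (P + \<i> * Q) = norm (P - \<i> * Q)"
    by (simp only: norm_mult)
  then have "norm (z - x) ^ n = norm (z - cnj x) ^ n"
    by (metis 1 2 norm_power)
  then have "norm (z - x) = norm (z - cnj x)"
    using n by (metis norm_ge_zero power_eq_iff_eq_base)
  then have "(Im z - Im x)\<^sup>2 = (Im z + Im x)\<^sup>2"
    by (simp add: cmod_def)
  then have "Im z * Im x = 0"
    by (simp add: power2_eq_square algebra_simps)
  then show False using z x by simp
qed

section \<open>Degrees and leading coefficients under the operator\<close>

text \<open>The falling factorial \<open>t (t - 1) ... (t - k + 1)\<close> as a polynomial in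
  \<open>t\<close>; at \<open>t = n\<close> it is the factor that \<open>k\<close> derivatives put
  on \<open>z^n\<close>. The factors are listed from the smallest, to match
  \<open>pochhammer\<close>.\<close>

definition ffact_poly :: "nat \<Rightarrow> real poly" where
  "ffact_poly k = (\<Prod>i<k. [:real i - real k + 1, 1:])"

lemma poly_ffact_poly: "k \<le> n \<Longrightarrow> poly (ffact_poly k) (real n) = pochhammer (real (Suc (n - k))) k"
  by (auto simp: ffact_poly_def poly_prod pochhammer_prod atLeast0LessThan of_nat_diff algebra_simps intro!: prod.cong)

lemma degree_ffact_poly: "degree (ffact_poly k) = k" and lead_coeff_ffact_poly: "lead_coeff (ffact_poly k) = 1"
proof -
  show "degree (ffact_poly k) = k"
    unfolding ffact_poly_def by (subst degree_prod_eq_sum_degree) auto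
  show "lead_coeff (ffact_poly k) = 1"
    unfolding ffact_poly_def by (simp add: lead_coeff_prod)
qed

lemma poly_eventually_same_sign:
  fixes Q :: "real poly"
  assumes "Q \<noteq> 0"
  obtains b where "\<And>x y. x \<ge> b \<Longrightarrow> y \<ge> b \<Longrightarrow> poly Q x * poly Q y > 0"
proof (cases "lead_coeff Q > 0")
  case True
  from poly_pinfty_gt_lc[OF this] show ?thesis
    using True that by (meson less_le_trans mult_pos_pos)
next
  case False
  then have "lead_coeff (- Q) > 0" using assms
    by (simp add: not_less order.strict_iff_order)
  from poly_pinfty_gt_lc[OF this] obtain b where "\<And>x. x \<ge> b \<Longrightarrow> - poly Q x > 0"
    using \<open>lead_coeff (- Q) > 0\<close> by fastforce
  then show ?thesis
    using that by (meson mult_neg_neg neg_0_less_iff_less)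
qed

text \<open>\<open>T\<close> shifts degrees by the fixed amount \<open>M - K = max (j - k)\<close>, and \<open>\<kappa> n\<close> is the factor by which it
  multiplies the leading coefficient of a polynomial of degree \<open>n\<close>.\<close>

lemma diff_op_lead:
  assumes "F \<noteq> 0"
  obtains K M :: nat and \<kappa> :: "nat \<Rightarrow> real" and N :: nat
  where "\<And>n. n \<ge> N \<Longrightarrow> \<kappa> n * \<kappa> (Suc n) > 0"
    and "\<And>g n. n \<ge> K \<Longrightarrow> degree g \<le> n \<Longrightarrow> degree (diff_op F g) \<le> n + M - K"
    and "\<And>g n. n \<ge> K \<Longrightarrow> degree g \<le> n \<Longrightarrow> coeff (diff_op F g) (n + M - K) = \<kappa> n * coeff g n"
proof -
  let ?j = "\<lambda>m. Poly_Mapping.lookup m (1::2)" and ?k = "\<lambda>m. Poly_Mapping.lookup m (2::2)"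
  let ?A = "Poly_Mapping.keys F"
  define K where "K = Max (?k ` ?A)"
  \<comment> \<open>Adding \<open>K\<close> keeps the subtraction of \<open>k\<close> exact in the
    natural numbers. \<open>B\<close> below collects the terms with the largest shift
    \<open>j - k\<close>, and \<open>poly Q n\<close> becomes \<open>\<kappa> n\<close>.\<close>
  define M where "M = Max ((\<lambda>m. ?j m + K - ?k m) ` ?A)"
  have ne: "?A \<noteq> {}" using assms by simp
  have K: "?k m \<le> K" if "m \<in> ?A" for m
    using that by (simp add: K_def)
  have M: "?j m + K - ?k m \<le> M" if "m \<in> ?A" for m
    using that by (simp add: M_def)
  define B where "B = {m \<in> ?A. ?j m + K - ?k m = M}"
  have "M \<in> (\<lambda>m. ?j m + K - ?k m) ` ?A"
    unfolding M_def using ne by (intro Max_in) auto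
  then have B: "B \<noteq> {}" "finite B" by (auto simp: B_def)
  define Q where "Q = (\<Sum>m\<in>B. smult (Poly_Mapping.lookup F m) (ffact_poly (?k m)))"
  \<comment> \<open>Terms in \<open>B\<close> share the value of \<open>j - k\<close>, so the one
    with the largest \<open>k\<close> is unique. It alone contributes to the coefficient of
    \<open>Q\<close> at that \<open>k\<close>, whence \<open>Q \<noteq> 0\<close>.\<close>
  obtain m0 where m0: "m0 \<in> B" "\<And>m. m \<in> B \<Longrightarrow> ?k m \<le> ?k m0"
  proof -
    have "Max (?k ` B) \<in> ?k ` B" using B by (intro Max_in) auto
    then obtain m0 where "m0 \<in> B" "?k m0 = Max (?k ` B)" by auto
    then show ?thesis using B that by (metis Max_ge finite_imageI imageI)
  qed
  have "coeff Q (?k m0) = (\<Sum>m\<in>B. if m = m0 then Poly_Mapping.lookup F m else 0)"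
    unfolding Q_def coeff_sum
  proof (rule sum.cong[OF refl])
    fix m assume m: "m \<in> B"
    show "coeff (smult (Poly_Mapping.lookup F m) (ffact_poly (?k m))) (?k m0) =
      (if m = m0 then Poly_Mapping.lookup F m else 0)"
    proof (cases "?k m = ?k m0")
      case True
      then have "?j m = ?j m0"
        using m m0 K[of m] K[of m0] by (auto simp: B_def)
      then have "m = m0" using True by (rule expo2_eqI)
      then show ?thesis
        using lead_coeff_ffact_poly[of "?k m0"] by (simp add: degree_ffact_poly)
    next
      case False
      then have "?k m < ?k m0" using m0(2)[OF m] by simp
      then show ?thesis by (auto simp: coeff_eq_0 degree_ffact_poly)
    qed
  qed
  also have "\<dots> = Poly_Mapping.lookup F m0"
    using m0 B by simp
  also have "\<dots> \<noteq> 0"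
    using m0(1) by (simp add: B_def in_keys_iff)
  finally have "Q \<noteq> 0" by auto
  from poly_eventually_same_sign[OF this] obtain b where
    b: "\<And>x y. x \<ge> b \<Longrightarrow> y \<ge> b \<Longrightarrow> poly Q x * poly Q y > 0" by blast
  \<comment> \<open>Indices above \<open>n + M - K\<close> are included, so one computation gives
    both the degree bound and the leading coefficient.\<close>
  have term0: "coeff (monom a (?j m) * (pderiv ^^ ?k m) g) i =
      (if i = n + M - K \<and> m \<in> B then a * poly (ffact_poly (?k m)) (real n) * coeff g n else 0)"
    if m: "m \<in> ?A" and n: "n \<ge> K" and g: "degree g \<le> n" and i: "i \<ge> n + M - K" for a m g n i
  proof (cases "?j m \<le> i")
    case True
    have eq: "coeff (monom a (?j m) * (pderiv ^^ ?k m) g) i =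
        a * (pochhammer (real (Suc (i - ?j m))) (?k m) * coeff g (i - ?j m + ?k m))"
      using True by (simp add: coeff_monom_mult coeff_higher_pderiv)
    show ?thesis
    proof (cases "i = n + M - K \<and> m \<in> B")
      case 1: True
      then have "i - ?j m = n - ?k m" "i - ?j m + ?k m = n"
        using K[OF m] n True by (auto simp: B_def)
      then show ?thesis
        unfolding eq using 1 poly_ffact_poly[OF order.trans[OF K[OF m] n]] by simp
    next
      case 1: False
      have "i - ?j m + ?k m > n"
        using 1 K[OF m] M[OF m] n i True m by (auto simp: B_def)
      then have "coeff g (i - ?j m + ?k m) = 0"
        using g by (intro coeff_eq_0) simp
      then show ?thesis unfolding eq if_not_P[OF 1] by simp
    qed
  next
    case False
    then have 1: "\<not> (i = n + M - K \<and> m \<in> B)"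
      using K[OF m] n by (auto simp: B_def)
    show ?thesis unfolding if_not_P[OF 1] using False by (simp add: coeff_monom_mult)
  qed
  have deg: "degree (diff_op F g) \<le> n + M - K" if "n \<ge> K" "degree g \<le> n" for g n
  proof (rule degree_le, intro allI impI)
    fix i assume "n + M - K < i"
    then show "coeff (diff_op F g) i = 0"
      using that by (simp add: diff_op_def coeff_sum term0)
  qed
  have lead: "coeff (diff_op F g) (n + M - K) = poly Q (real n) * coeff g n"
    if "n \<ge> K" "degree g \<le> n" for g n
  proof -
    have "coeff (diff_op F g) (n + M - K) =
       (\<Sum>m\<in>?A. if m \<in> B then Poly_Mapping.lookup F m * poly (ffact_poly (?k m)) (real n) * coeff g n else 0)"
      using that by (simp add: diff_op_def coeff_sum term0)
    also have "\<dots> = (\<Sum>m\<in>B. Poly_Mapping.lookup F m * poly (ffact_poly (?k m)) (real n) * coeff g n)"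
      by (simp add: sum.inter_filter[symmetric] B_def)
    finally show ?thesis
      by (simp add: Q_def poly_sum sum_distrib_right)
  qed
  show ?thesis
  proof (rule that[of "nat \<lceil>b\<rceil>" "\<lambda>n. poly Q (real n)" K M])
    show "0 < poly Q (real n) * poly Q (real (Suc n))" if "nat \<lceil>b\<rceil> \<le> n" for n
      using that by (intro b) linarith+
  qed (use deg lead in auto)
qed

text \<open>Write \<open>(z - x)^n = p + i q\<close> with real \<open>p\<close> and
  \<open>q\<close>. Then \<open>p\<close> is monic of degree \<open>n\<close>, and \<open>q\<close>
  has degree \<open>n - 1\<close> and leading coefficient \<open>- n Im x > 0\<close>. For large
  \<open>n\<close> the images of \<open>p\<close> and \<open>q\<close> keep this degree gap and the
  agreement of signs, so Hermite-Biehler applies. The bound on \<open>n\<close> is uniform in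
  \<open>x\<close>.\<close>

lemma preserver_linear_power:
  assumes F: "F \<noteq> 0" and pres: "diff_op F ` real_rooted \<subseteq> real_rooted \<union> {0}"
  obtains N where "\<And>n x z. n \<ge> N \<Longrightarrow> Im x < 0 \<Longrightarrow> Im z > 0 \<Longrightarrow> poly (cdiff_op F ([:-x, 1:] ^ n)) z \<noteq> 0"
proof -
  obtain K M :: nat and \<kappa> :: "nat \<Rightarrow> real" and N :: nat where
    N: "\<And>n. n \<ge> N \<Longrightarrow> \<kappa> n * \<kappa> (Suc n) > 0"
    and deg: "\<And>g n. n \<ge> K \<Longrightarrow> degree g \<le> n \<Longrightarrow> degree (diff_op F g) \<le> n + M - K"
    and lead: "\<And>g n. n \<ge> K \<Longrightarrow> degree g \<le> n \<Longrightarrow> coeff (diff_op F g) (n + M - K) = \<kappa> n * coeff g n"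
    using diff_op_lead[OF F] by metis
  show ?thesis
  \<comment> \<open>The successor makes \<open>n - 1\<close>, the degree of \<open>q\<close>, large
    enough as well.\<close>
  proof (rule that[of "Suc (max N K)"])
    fix n x z assume n: "n \<ge> Suc (max N K)" and x: "Im x < 0" and z: "Im z > 0"
    then obtain n' where n': "n = Suc n'" "n' \<ge> N" "n' \<ge> K"
      by (cases n) auto
    define f where "f = [:-x, 1:] ^ n"
    define p where "p = map_poly Re f"
    define q where "q = map_poly Im f"
    have f: "f = cpoly p + smult \<i> (cpoly q)"
      by (simp add: poly_eq_iff p_def q_def coeff_map_poly complex_eq_iff)
    have degf: "degree f = n"
      by (simp add: f_def degree_power_eq)
    have fn: "coeff f n = 1"
      by (simp add: f_def coeff_linear_power)
    have degp: "degree p \<le> n"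
      unfolding p_def using degf map_poly_degree_leq[of Re f] by simp
    have degq: "degree q \<le> n'"
    proof (rule degree_le, intro allI impI)
      fix i assume "n' < i"
      then show "coeff q i = 0"
        using fn degf n' by (cases "i = n") (auto simp: q_def coeff_map_poly coeff_eq_0)
    qed
    have cp: "coeff p n = 1"
      by (simp add: p_def coeff_map_poly f_def coeff_linear_poly_power)
    have "coeff f n' = of_nat n * - x"
      unfolding f_def by (subst coeff_linear_poly_power) (use n' in auto)
    then have cq: "coeff q n' = - real n * Im x"
      by (simp add: q_def coeff_map_poly)
    define U where "U = diff_op F p"
    define V where "V = diff_op F q"
    have \<kappa>: "\<kappa> n \<noteq> 0" "\<kappa> n' \<noteq> 0"
      using N[of n'] n' by auto
    have cU: "coeff U (n + M - K) = \<kappa> n" "degree U \<le> n + M - K"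
      unfolding U_def using deg[of n p] lead[of n p] n' degp cp by simp_all
    have cV: "coeff V (n' + M - K) = \<kappa> n' * (- real n * Im x)" "degree V \<le> n' + M - K"
      unfolding V_def using deg[OF n'(3) degq] lead[OF n'(3) degq] cq by simp_all
    have nx: "- real n * Im x > 0"
      using x n'(1) by (intro mult_neg_neg) auto
    have dU: "degree U = n + M - K"
      using cU(1) \<kappa>(1) by (intro antisym[OF cU(2)] le_degree) simp
    have Vnz: "coeff V (n' + M - K) \<noteq> 0"
      unfolding cV(1) using \<kappa>(2) nx by (metis less_irrefl mult_eq_0_iff)
    have dV: "degree V = n' + M - K"
      by (intro antisym[OF cV(2)] le_degree) (rule Vnz)
    have "poly (cpoly U) z + \<i> * poly (cpoly V) z \<noteq> 0"
    proof (rule hermite_biehler)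
      show "V \<noteq> 0" using Vnz by auto
      show "degree U = Suc (degree V)" using dU dV n' by simp
      have "\<kappa> n * \<kappa> n' > 0"
        using N[OF n'(2)] unfolding n'(1) by (simp only: mult.commute)
      from mult_pos_pos[OF this nx] have "\<kappa> n * \<kappa> n' * (- real n * Im x) > 0" .
      then show "lead_coeff U * lead_coeff V > 0"
        unfolding dU dV cU(1) cV(1) by (simp only: mult_ac)
      fix a b :: real assume ab: "a \<noteq> 0 \<or> b \<noteq> 0"
      have "smult a p + smult b q \<noteq> 0"
      proof
        assume 0: "smult a p + smult b q = 0"
        have "coeff (smult a p + smult b q) n = a"
          using cp coeff_eq_0[of q n] degq n'(1) by simp
        with 0 have "a = 0" by simp
        with 0 ab have "q = 0" by simp
        with cq nx show False by (metis coeff_0 less_irrefl)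
      qed
      then have "smult a p + smult b q \<in> real_rooted"
        using linear_power_real_combination[OF f[unfolded f_def] _ x ab] n' by (simp add: real_rooted_def)
      then have "diff_op F (smult a p + smult b q) \<in> real_rooted \<union> {0}"
        using pres by blast
      moreover have eq: "cpoly (diff_op F (smult a p + smult b q)) = cpoly (smult a U + smult b V)"
        by (simp add: U_def V_def cdiff_op_cpoly[symmetric] cpoly_add cpoly_smult cdiff_op_add cdiff_op_smult)
      have "diff_op F (smult a p + smult b q) = smult a U + smult b V"
        using eq unfolding cpoly_eq_iff .
      \<comment> \<open>A preserver may send a polynomial to 0; the leading coefficients rule this
        out here.\<close>
      moreover have "smult a U + smult b V \<noteq> 0"
      proof
        assume 0: "smult a U + smult b V = 0"
        have "coeff (smult a U + smult b V) (n + M - K) = a * \<kappa> n"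
          using cU(1) coeff_eq_0[of V "n + M - K"] dV n'(1,3) by simp
        with 0 \<kappa> have "a = 0" by simp
        with 0 ab have "V = 0" by simp
        with Vnz show False by simp
      qed
      ultimately show "only_real_zeros (smult a U + smult b V)"
        by (auto simp: real_rooted_def)
    qed (rule z)
    then show "poly (cdiff_op F ([:-x, 1:] ^ n)) z \<noteq> 0"
      unfolding f_def[symmetric] f by (simp add: cdiff_op_add cdiff_op_smult cdiff_op_cpoly U_def V_def)
  qed
qed

section \<open>The symbol as a limit of images of linear powers\<close>

lemma poly_higher_pderiv_linear_power:
  fixes x :: complex
  shows "k \<le> n \<Longrightarrow> poly ((pderiv ^^ k) ([:-x, 1:] ^ n)) z = (\<Prod>i<k. of_nat n - of_nat i) * (z - x) ^ (n - k)"
proof -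
  assume "k \<le> n"
  then have "(pderiv ^^ k) ([:-x, 1:] ^ n) = smult (\<Prod>i<k. of_nat n - of_nat i) ([:-x, 1:] ^ (n - k))"
  proof (induction k)
    case (Suc k)
    obtain l where "n = k + Suc l"
      using Suc.prems less_imp_Suc_add[of k n] by auto
    then have "pderiv ([:-x, 1:] ^ (n - k)) = smult (of_nat n - of_nat k) ([:-x, 1:] ^ (n - Suc k))"
      by (simp add: pderiv_power_Suc pderiv_pCons del: power_Suc)
    then show ?case using Suc by (simp add: pderiv_smult mult.commute)
  qed simp
  then show ?thesis by (simp add: poly_power)
qed

lemma bivariate_nonzero:
  fixes a :: "(2 \<Rightarrow>\<^sub>0 nat) \<Rightarrow> real"
  assumes "finite A" "m \<in> A" "a m \<noteq> 0"
  obtains x y where "(\<Sum>m\<in>A. a m * (x ^ Poly_Mapping.lookup m 1 * y ^ Poly_Mapping.lookup m 2)) \<noteq> 0"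
proof (rule ccontr)
  assume "\<not> thesis"
  with that have 0: "(\<Sum>m\<in>A. a m * (x ^ Poly_Mapping.lookup m 1 * y ^ Poly_Mapping.lookup m 2)) = 0" for x y
    by blast
  let ?h = "\<lambda>m. (Poly_Mapping.lookup m (1::2), Poly_Mapping.lookup m (2::2))"
  have inj: "inj_on ?h A"
    by (rule inj_onI) (auto intro: expo2_eqI)
  define c where "c x = a (expo2 (fst x) (snd x))" for x
  have c: "c (?h m) = a m" for m
    unfolding c_def by (intro arg_cong[of _ _ a] expo2_eqI) simp_all
  have "c (?h m) = 0"
  proof (rule bivariate_zero)
    show "(\<Sum>x\<in>?h ` A. c x * (z ^ fst x * w ^ snd x)) = 0" for z w
      using 0[of z w] by (simp add: sum.reindex[OF inj] c)
  qed (use assms in auto)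
  with assms c show False by simp
qed

text \<open>This is a polynomial version of \<open>T e^(-z w) = F(z, -w) e^(-z w)\<close>, with
  \<open>(1 - z w / r)^r\<close> in place of the exponential. That power is a multiple of
  \<open>(z - x)^r\<close> with \<open>x = r / w\<close>, which lies in the lower
  half-plane.\<close>

lemma preserver_imp_stable:
  assumes F: "F \<noteq> 0" and pres: "diff_op F ` real_rooted \<subseteq> real_rooted \<union> {0}"
  shows "stable_symbol F"
proof -
  let ?j = "\<lambda>m. Poly_Mapping.lookup m (1::2)" and ?k = "\<lambda>m. Poly_Mapping.lookup m (2::2)"
  let ?A = "Poly_Mapping.keys F"
  define K where "K = Max (insert 0 (?k ` ?A))"
  have K: "?k m \<le> K" if "m \<in> ?A" for m
    using that by (simp add: K_def)
  obtain N where N: "\<And>n x z. n \<ge> N \<Longrightarrow> Im x < 0 \<Longrightarrow> Im z > 0 \<Longrightarrow> poly (cdiff_op F ([:-x, 1:] ^ n)) z \<noteq> 0"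
    using preserver_linear_power[OF F pres] by blast
  \<comment> \<open>With \<open>e = 1 / r\<close>, this is what remains of the image of
    \<open>(1 - e z w)^r\<close> after the common factor \<open>(1 - e z w)^(r - K)\<close> is split
    off. At \<open>e = 0\<close> it is \<open>F(z, -w)\<close>.\<close>
  define H where "H e z w = (\<Sum>m\<in>?A. of_real (Poly_Mapping.lookup F m) * z ^ ?j m * (- w) ^ ?k m *
     (1 - of_real e * z * w) ^ (K - ?k m) * (\<Prod>i<?k m. 1 - of_nat i * of_real e))"
    for e :: real and z w :: complex
  define e where "e n = 1 / real (Suc (n + max N K))" for n
  have H0: "H 0 z w = ceval F (vector [z, - w])" for z w
    by (simp add: H_def ceval_2 mult.assoc)
  have nz: "H (e n) z w \<noteq> 0" if zw: "Im z > 0" "Im w > 0" for n z w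
  proof -
    define r where "r = Suc (n + max N K)"
    have r: "r \<ge> N" "r > K" "e n = 1 / real r"
      by (auto simp: r_def e_def)
    have w0: "w \<noteq> 0" using zw by auto
    define c where "c = - w / of_nat r"
    define x where "x = of_nat r / w"
    have "Im x < 0"
    proof -
      have "Im x = - (real r * Im w / (norm w)\<^sup>2)"
        unfolding x_def by (simp add: Im_divide cmod_power2)
      then show ?thesis using r zw w0 by (simp add: zero_less_divide_iff)
    qed
    have lin: "c * (z - x) = 1 - of_real (e n) * z * w"
    proof -
      have "complex_of_nat r \<noteq> 0" using r(2) by simp
      then show ?thesis
        unfolding c_def x_def r(3) using w0 by (simp add: field_simps)
    qed
    have "c ^ r * poly (cdiff_op F ([:-x, 1:] ^ r)) z = H (e n) z w * (1 - of_real (e n) * z * w) ^ (r - K)"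
      unfolding cdiff_op_def poly_sum H_def sum_distrib_left sum_distrib_right
    proof (rule sum.cong[OF refl])
      fix m assume m: "m \<in> ?A"
      have km: "?k m \<le> r" using K[OF m] r by simp
      have "c ^ r = c ^ ?k m * c ^ (r - ?k m)"
        using km by (simp flip: power_add)
      then have "c ^ r * ((\<Prod>i<?k m. of_nat r - of_nat i) * (z - x) ^ (r - ?k m)) =
          (c ^ ?k m * (\<Prod>i<?k m. of_nat r - of_nat i)) * (c * (z - x)) ^ (r - ?k m)"
        by (simp add: power_mult_distrib)
      also have "c ^ ?k m * (\<Prod>i<?k m. of_nat r - of_nat i) = (\<Prod>i<?k m. c * (of_nat r - of_nat i))"
        by (simp add: prod.distrib)
      also have "\<dots> = (\<Prod>i<?k m. - w * (1 - of_nat i * of_real (e n)))"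
      proof (intro prod.cong refl)
        fix i
        have "complex_of_nat r \<noteq> 0" using r(2) by simp
        then show "c * (of_nat r - of_nat i) = - w * (1 - of_nat i * of_real (e n))"
          unfolding c_def r(3) by (simp add: field_simps)
      qed
      also have "\<dots> = (- w) ^ ?k m * (\<Prod>i<?k m. 1 - of_nat i * of_real (e n))"
        by (simp only: prod.distrib prod_constant card_lessThan)
      also have "(c * (z - x)) ^ (r - ?k m) = (1 - of_real (e n) * z * w) ^ (K - ?k m) * (1 - of_real (e n) * z * w) ^ (r - K)"
        unfolding lin using K[OF m] r by (simp flip: power_add)
      finally show "c ^ r * poly (monom (of_real (Poly_Mapping.lookup F m)) (?j m) * (pderiv ^^ ?k m) ([:-x, 1:] ^ r)) z =
         of_real (Poly_Mapping.lookup F m) * z ^ ?j m * (- w) ^ ?k m *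
         (1 - of_real (e n) * z * w) ^ (K - ?k m) * (\<Prod>i<?k m. 1 - of_nat i * of_real (e n)) *
         (1 - of_real (e n) * z * w) ^ (r - K)"
        unfolding poly_mult poly_higher_pderiv_linear_power[OF km] by (simp add: poly_monom mult_ac)
    qed
    moreover have "c ^ r * poly (cdiff_op F ([:-x, 1:] ^ r)) z \<noteq> 0"
      using N[OF r(1) \<open>Im x < 0\<close> zw(1)] w0 r by (simp add: c_def)
    ultimately show ?thesis by auto
  qed
  obtain m where "m \<in> ?A"
    using F by fastforce
  then obtain a b where "meval F (vector [a, b]) \<noteq> 0"
    using bivariate_nonzero[of ?A m "Poly_Mapping.lookup F"]
    by (auto simp: in_keys_iff msubst_def prod_UNIV_2)
  moreover have "complex_of_real (meval F (vector [a, b])) = H 0 (of_real a) (of_real (- b))"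
    unfolding H0 by (simp add: msubst_def prod_UNIV_2)
  ultimately have ex: "H 0 (of_real a) (of_real (- b)) \<noteq> 0"
    by (metis of_real_eq_0_iff)
  have "H 0 z w \<noteq> 0" if "Im z > 0" "Im w > 0" for z w
  proof (rule hurwitz_two[of H e 0 a "- b"])
    show "continuous_on UNIV (\<lambda>(e, z, w). H e z w)"
      unfolding H_def case_prod_unfold by (intro continuous_intros)
    show "(\<lambda>t. H e (z + t * a) (w + t * b)) holomorphic_on UNIV" for e z w a b
      unfolding H_def by (intro holomorphic_intros)
    have "(\<lambda>n. 1 / real (Suc (n + max N K))) \<longlonglongrightarrow> 0"
      using LIMSEQ_ignore_initial_segment[OF LIMSEQ_inverse_real_of_nat, of "max N K"]
      by (simp add: inverse_eq_divide)
    then show "e \<longlonglongrightarrow> 0"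
      by (simp add: e_def[abs_def])
  qed (use nz ex that in auto)
  then show ?thesis
    by (simp add: stable_symbol_def H0)
qed

subsection \<open>The homogenized symbol\<close>

lemma ceval_3: "ceval G (vector [y, z, w]) =
   (\<Sum>m\<in>Poly_Mapping.keys G. of_real (Poly_Mapping.lookup G m) *
      (y ^ Poly_Mapping.lookup m 1 * z ^ Poly_Mapping.lookup m 2 * w ^ Poly_Mapping.lookup m (3::3)))"
  by (simp add: msubst_def prod_UNIV_3)

lemma ceval_3_homogeneous:
  fixes G :: "3 mpoly"
  assumes "homogeneous d G"
  shows "ceval G (vector [c * y, c * z, c * w]) = c ^ d * ceval G (vector [y, z, w])"
  unfolding ceval_3 sum_distrib_left
proof (rule sum.cong[OF refl])
  fix m assume "m \<in> Poly_Mapping.keys G"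
  then have "d = Poly_Mapping.lookup m 1 + Poly_Mapping.lookup m 2 + Poly_Mapping.lookup m 3"
    using assms by (auto simp: homogeneous_def monom_degree_def sum_3)
  then show "complex_of_real (Poly_Mapping.lookup G m) * ((c * y) ^ Poly_Mapping.lookup m 1 *
      (c * z) ^ Poly_Mapping.lookup m 2 * (c * w) ^ Poly_Mapping.lookup m 3) =
    c ^ d * (complex_of_real (Poly_Mapping.lookup G m) * (y ^ Poly_Mapping.lookup m 1 *
      z ^ Poly_Mapping.lookup m 2 * w ^ Poly_Mapping.lookup m 3))"
    by (simp add: power_mult_distrib power_add mult_ac)
qed

lemma ceval_3_cnj: "ceval G (vector [cnj y, cnj z, cnj w]) = cnj (ceval G (vector [y, z, w]))"
  for G :: "3 mpoly"
  by (simp add: ceval_3)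

lemma ceval_3_of_real:
  "ceval G (vector [of_real y, of_real z, of_real w]) = of_real (meval G (vector [y, z, w]))"
  for G :: "3 mpoly"
  by (simp add: ceval_3 msubst_def prod_UNIV_3)

lemma continuous_on_ceval_3 [continuous_intros]:
  fixes G :: "3 mpoly"
  assumes "continuous_on S f" "continuous_on S g" "continuous_on S h"
  shows "continuous_on S (\<lambda>x. ceval G (vector [f x, g x, h x]))"
  unfolding ceval_3 using assms by (intro continuous_intros)

lemma holomorphic_on_ceval_3 [holomorphic_intros]:
  fixes G :: "3 mpoly"
  assumes "f holomorphic_on S" "g holomorphic_on S" "h holomorphic_on S"
  shows "(\<lambda>x. ceval G (vector [f x, g x, h x])) holomorphic_on S"
  unfolding ceval_3 using assms by (intro holomorphic_intros)

lemma poly_msubst_poly: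
  fixes G :: "3 mpoly"
  shows "poly (cpoly (msubst_poly G X)) t =
    ceval G (vector [poly (cpoly (X $ 1)) t, poly (cpoly (X $ 2)) t, poly (cpoly (X $ 3)) t])"
  by (simp add: ceval_3 msubst_def prod_UNIV_3 cpoly_sum cpoly_mult cpoly_power poly_sum poly_power
      map_poly_pCons cpoly_smult mult_ac)

lemma complex_poly_zero_if_zero_on_reals:
  fixes p :: "complex poly"
  assumes "\<And>x. poly p (of_real x) = 0"
  shows "p = 0"
proof (rule ccontr)
  assume "p \<noteq> 0"
  then have "finite {z. poly p z = 0}" by (rule poly_roots_finite)
  moreover have "range complex_of_real \<subseteq> {z. poly p z = 0}"
    using assms by auto
  ultimately have "finite (range complex_of_real)"
    by (rule finite_subset[rotated])
  then show False
    using finite_imageD[of complex_of_real UNIV] infinite_UNIV_char_0[where ?'a = real]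
    by (auto simp: inj_on_def)
qed

text \<open>The difference of both sides is polynomial in each variable and vanishes at real points.
  A polynomial vanishing on the reals is zero; this is used first in \<open>w\<close> for real
  \<open>z\<close>, then in \<open>z\<close> for arbitrary \<open>w\<close>.\<close>

lemma is_homogenization_complex:
  assumes "is_homogenization d F G"
  shows "ceval G (vector [1, z, w]) = ceval F (vector [z, - w])"
proof -
  define D where "D z w = ceval G (vector [1, z, w]) - ceval F (vector [z, - w])" for z w
  have D_real: "D (of_real x) (of_real y) = 0" for x y
  proof -
    have "ceval G (vector [1, of_real x, of_real y]) = of_real (meval G (vector [1, x, y]))"
      using ceval_3_of_real[of G 1 x y] by simp
    also have "\<dots> = of_real (meval F (vector [x, - y]))"
      using assms by (simp add: is_homogenization_def)
    also have "\<dots> = ceval F (vector [of_real x, - of_real y])"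
      by (simp add: ceval_2 msubst_def prod_UNIV_2)
    finally show ?thesis by (simp add: D_def)
  qed
  have Dw: "\<exists>p. \<forall>w. poly p w = D z w" for z
  proof (intro exI allI)
    fix w
    show "poly ((\<Sum>m\<in>Poly_Mapping.keys G. monom (of_real (Poly_Mapping.lookup G m) * z ^ Poly_Mapping.lookup m 2)
          (Poly_Mapping.lookup m 3)) -
       (\<Sum>m\<in>Poly_Mapping.keys F. monom (of_real (Poly_Mapping.lookup F m) * z ^ Poly_Mapping.lookup m 1 *
          (- 1) ^ Poly_Mapping.lookup m 2) (Poly_Mapping.lookup m 2))) w = D z w"
      by (simp add: D_def ceval_2 ceval_3 poly_sum poly_monom power_minus[of w] mult.assoc)
  qed
  have Dz: "\<exists>p. \<forall>z. poly p z = D z w" for w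
    by (rule exI[of _ "(\<Sum>m\<in>Poly_Mapping.keys G. monom (of_real (Poly_Mapping.lookup G m) * w ^ Poly_Mapping.lookup m 3) (Poly_Mapping.lookup m 2)) -
       (\<Sum>m\<in>Poly_Mapping.keys F. monom (of_real (Poly_Mapping.lookup F m) * (- w) ^ Poly_Mapping.lookup m 2) (Poly_Mapping.lookup m 1))"])
       (simp add: D_def ceval_2 ceval_3 poly_sum poly_monom mult_ac)
  have "D (of_real x) w = 0" for x w
  proof -
    obtain p where p: "\<And>w. poly p w = D (of_real x) w" using Dw by blast
    then have "p = 0" using D_real by (intro complex_poly_zero_if_zero_on_reals) simp
    then show ?thesis using p[of w] by simp
  qed
  moreover obtain p where p: "\<And>z. poly p z = D z w" using Dz by blast
  ultimately have "p = 0"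
    by (intro complex_poly_zero_if_zero_on_reals) simp
  then show ?thesis using p[of z] by (simp add: D_def)
qed

text \<open>The values at \<open>y = 1\<close> determine those at \<open>e \<noteq> 0\<close> by
  scaling and the one at \<open>e = 0\<close> by continuity. At \<open>e = 0\<close> the formula
  exhibits the top-degree part of \<open>F\<close>.\<close>

lemma meval_homogenization:
  assumes hom: "is_homogenization d F G" and d: "total_degree F = d"
  shows "meval G (vector [e, x, y]) = (\<Sum>m\<in>Poly_Mapping.keys F. Poly_Mapping.lookup F m *
     e ^ (d - monom_degree m) * (x ^ Poly_Mapping.lookup m 1 * (- y) ^ Poly_Mapping.lookup m 2))"
    (is "?L e = ?R e")
proof -
  have ne: "?L e = ?R e" if e: "e \<noteq> 0" for e
  proof -
    have "complex_of_real (?L e) = ceval G (vector [of_real e * 1, of_real e * of_real (x / e), of_real e * of_real (y / e)])"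
      using e by (simp flip: ceval_3_of_real)
    also have "\<dots> = of_real e ^ d * ceval G (vector [of_real 1, of_real (x / e), of_real (y / e)])"
      unfolding of_real_1 by (rule ceval_3_homogeneous) (use hom in \<open>simp add: is_homogenization_def\<close>)
    also have "ceval G (vector [of_real 1, of_real (x / e), of_real (y / e)]) = of_real (meval G (vector [1, x / e, y / e]))"
      by (simp only: ceval_3_of_real)
    also have "meval G (vector [1, x / e, y / e]) = meval F (vector [x / e, - (y / e)])"
      using hom by (simp add: is_homogenization_def)
    finally have "complex_of_real (?L e) = of_real (e ^ d * meval F (vector [x / e, - (y / e)]))"
      by simp
    then have "?L e = e ^ d * meval F (vector [x / e, - (y / e)])"
      by (simp only: of_real_eq_iff)
    also have "\<dots> = ?R e"
      unfolding msubst_def sum_distrib_left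
    proof (rule sum.cong[OF refl])
      fix m assume m: "m \<in> Poly_Mapping.keys F"
      have "monom_degree m \<le> d"
        using m d by (auto simp: total_degree_def)
      then have 1: "e ^ d = e ^ (d - monom_degree m) * (e ^ Poly_Mapping.lookup m 1 * e ^ Poly_Mapping.lookup m 2)"
        by (simp add: monom_degree_def sum_2 flip: power_add)
      have 2: "e ^ Poly_Mapping.lookup m 2 * (- (y / e)) ^ Poly_Mapping.lookup m 2 = (- y) ^ Poly_Mapping.lookup m 2"
        using e by (simp flip: power_mult_distrib)
      have 3: "e ^ Poly_Mapping.lookup m 1 * (x / e) ^ Poly_Mapping.lookup m 1 = x ^ Poly_Mapping.lookup m 1"
        using e by (simp flip: power_mult_distrib)
      have "e ^ d * (Poly_Mapping.lookup F m * (\<Prod>i\<in>UNIV. (vector [x / e, - (y / e)] :: real ^ 2) $ i ^ Poly_Mapping.lookup m i)) =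
          e ^ d * (Poly_Mapping.lookup F m * ((x / e) ^ Poly_Mapping.lookup m 1 * (- (y / e)) ^ Poly_Mapping.lookup m 2))"
        by (simp add: prod_UNIV_2)
      also have "\<dots> = Poly_Mapping.lookup F m * e ^ (d - monom_degree m) *
          ((e ^ Poly_Mapping.lookup m 1 * (x / e) ^ Poly_Mapping.lookup m 1) *
           (e ^ Poly_Mapping.lookup m 2 * (- (y / e)) ^ Poly_Mapping.lookup m 2))"
        unfolding 1 by (simp only: mult_ac)
      finally show "e ^ d * (Poly_Mapping.lookup F m * (\<Prod>i\<in>UNIV. (vector [x / e, - (y / e)] :: real ^ 2) $ i ^ Poly_Mapping.lookup m i)) =
          Poly_Mapping.lookup F m * e ^ (d - monom_degree m) * (x ^ Poly_Mapping.lookup m 1 * (- y) ^ Poly_Mapping.lookup m 2)"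
        unfolding 2 3 .
    qed
    finally show ?thesis .
  qed
  have "isCont ?L 0" "isCont ?R 0"
    by (simp_all add: msubst_def prod_UNIV_3)
  then have "isCont (\<lambda>e. ?L e - ?R e) 0"
    by (rule isCont_diff)
  then have "(\<lambda>e. ?L e - ?R e) \<midarrow>0\<rightarrow> ?L 0 - ?R 0"
    by (simp add: isCont_def)
  moreover have "(\<lambda>e. ?L e - ?R e) \<midarrow>0\<rightarrow> 0"
    by (rule tendsto_eventually) (auto simp: eventually_at ne intro!: exI[of _ 1])
  ultimately have "?L 0 - ?R 0 = 0"
    by (rule LIM_unique)
  then show ?thesis using ne by (cases "e = 0") auto
qed

text \<open>At \<open>y = 0\<close> only the terms of degree \<open>d\<close> survive, where the
  power of 0 is \<open>0 ^ 0 = 1\<close>. Such a term exists because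
  \<open>F \<noteq> 0\<close>.\<close>

lemma exists_top_nonzero:
  assumes F: "F \<noteq> 0" and d: "total_degree F = d" and hom: "is_homogenization d F G"
  obtains x y where "meval G (vector [0, x, y]) \<noteq> 0"
proof -
  define A where "A = {m \<in> Poly_Mapping.keys F. monom_degree m = d}"
  have "d \<in> insert 0 (monom_degree ` Poly_Mapping.keys F)"
    unfolding d[symmetric] total_degree_def by (rule Max_in) auto
  moreover have le: "monom_degree m \<le> d" if "m \<in> Poly_Mapping.keys F" for m
    using that d by (auto simp: total_degree_def)
  \<comment> \<open>If \<open>d\<close> is the inserted default 0, then \<open>m1\<close> has degree
    at most 0 and serves as the term of degree \<open>d\<close>.\<close>
  moreover obtain m1 where "m1 \<in> Poly_Mapping.keys F"
    using F by fastforce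
  ultimately obtain m where m: "m \<in> A"
    unfolding A_def by force
  obtain x y where xy: "(\<Sum>m\<in>A. Poly_Mapping.lookup F m * (x ^ Poly_Mapping.lookup m 1 * y ^ Poly_Mapping.lookup m 2)) \<noteq> 0"
    by (rule bivariate_nonzero[of A m "Poly_Mapping.lookup F"]) (use m in \<open>auto simp: A_def in_keys_iff\<close>)
  have "meval G (vector [0, x, - y]) =
      (\<Sum>m\<in>A. Poly_Mapping.lookup F m * (x ^ Poly_Mapping.lookup m 1 * y ^ Poly_Mapping.lookup m 2))"
    unfolding meval_homogenization[OF hom d] minus_minus A_def
  proof (rule sum.mono_neutral_cong_right)
    show "\<forall>i\<in>Poly_Mapping.keys F - {m \<in> Poly_Mapping.keys F. monom_degree m = d}.
       Poly_Mapping.lookup F i * 0 ^ (d - monom_degree i) * (x ^ Poly_Mapping.lookup i 1 * y ^ Poly_Mapping.lookup i 2) = 0"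
    proof
      fix i assume "i \<in> Poly_Mapping.keys F - {m \<in> Poly_Mapping.keys F. monom_degree m = d}"
      then have "d - monom_degree i > 0" using le[of i] by auto
      then show "Poly_Mapping.lookup F i * 0 ^ (d - monom_degree i) * (x ^ Poly_Mapping.lookup i 1 * y ^ Poly_Mapping.lookup i 2) = 0"
        by simp
    qed
  qed auto
  with xy that show ?thesis by metis
qed

section \<open>Stability implies hyperbolicity\<close>

text \<open>For \<open>y > 0\<close>, divide all arguments by \<open>y\<close>. For
  \<open>y < 0\<close>, passing to \<open>(-y, - cnj z, - cnj w)\<close> keeps both half-planes and
  the vanishing of \<open>G\<close>, which reduces to \<open>y > 0\<close>. For
  \<open>y = 0\<close>, let positive values tend to 0; the limit is not identically zero because the
  top-degree part of \<open>F\<close> is nonzero.\<close>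

lemma stable_homogenization_nonzero:
  assumes st: "stable_symbol F" and F: "F \<noteq> 0" and d: "total_degree F = d"
    and hom: "is_homogenization d F G" and z: "Im z > 0" and w: "Im w > 0"
  shows "ceval G (vector [of_real y, z, w]) \<noteq> 0"
proof -
  have hd: "homogeneous d G"
    using hom by (simp add: is_homogenization_def)
  have pos: "ceval G (vector [of_real y, z, w]) \<noteq> 0"
    if y: "y > 0" and z: "Im z > 0" and w: "Im w > 0" for y z w
  proof -
    have "ceval G (vector [of_real y, z, w]) =
        ceval G (vector [of_real y * 1, of_real y * (z / of_real y), of_real y * (w / of_real y)])"
      using y by simp
    also have "\<dots> = of_real y ^ d * ceval F (vector [z / of_real y, - (w / of_real y)])"
      by (simp only: ceval_3_homogeneous[OF hd] is_homogenization_complex[OF hom])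
    also have "\<dots> \<noteq> 0"
      using st y z w by (auto simp: stable_symbol_def)
    finally show ?thesis .
  qed
  show ?thesis
  proof (cases y "0 :: real" rule: linorder_cases)
    case greater
    then show ?thesis using pos z w by blast
  next
    case less
    have "ceval G (vector [of_real (- y), - cnj z, - cnj w]) \<noteq> 0"
      using less z w by (intro pos) auto
    moreover have "ceval G (vector [of_real (- y), - cnj z, - cnj w]) =
        (- 1) ^ d * cnj (ceval G (vector [of_real y, z, w]))"
      using ceval_3_homogeneous[OF hd, of "- 1" "of_real y" "cnj z" "cnj w"]
        ceval_3_cnj[of G "of_real y" z w] by simp
    ultimately show ?thesis by auto
  next
    case equal
    obtain a b where "meval G (vector [0, a, b]) \<noteq> 0"
      using exists_top_nonzero[OF F d hom] by blast
    then have ab: "ceval G (vector [of_real 0, of_real a, of_real b]) \<noteq> 0"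
      unfolding ceval_3_of_real by simp
    show ?thesis
      unfolding equal
    proof (rule hurwitz_two[of "\<lambda>e z w. ceval G (vector [of_real e, z, w])" "\<lambda>n. 1 / real (Suc n)", OF _ _ _ _ ab z w])
      show "continuous_on UNIV (\<lambda>(e, z, w). ceval G (vector [complex_of_real e, z, w]))"
        unfolding case_prod_unfold by (intro continuous_intros)
      show "(\<lambda>t. ceval G (vector [of_real e, z + t * a, w + t * b])) holomorphic_on UNIV" for e z w a b
        by (intro holomorphic_intros)
      show "(\<lambda>n. 1 / real (Suc n)) \<longlonglongrightarrow> 0"
        using LIMSEQ_inverse_real_of_nat by (simp add: inverse_eq_divide)
      show "ceval G (vector [of_real (1 / real (Suc n)), z, w]) \<noteq> 0" if "Im z > 0" "Im w > 0" for n z w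
        using that by (intro pos) auto
    qed
  qed
qed

lemma poly_cpoly_linear: "poly (cpoly [:a, b:]) t = of_real a + t * of_real b"
  by (simp add: map_poly_pCons)

lemma poly_line_restriction:
  fixes G :: "3 mpoly"
  shows "poly (cpoly (msubst_poly G (\<chi> i. [:\<alpha> $ i, (vector [0, 1, 1] :: real ^ 3) $ i:]))) t =
    ceval G (vector [of_real (\<alpha> $ 1), of_real (\<alpha> $ 2) + t, of_real (\<alpha> $ 3) + t])"
  by (simp only: poly_msubst_poly vec_lambda_beta vector_3 poly_cpoly_linear
      of_real_0 of_real_1 mult_1_right mult_zero_right add_0_right)

lemma poly_leading_restriction:
  fixes G :: "3 mpoly"
  shows "poly (cpoly (msubst_poly G (vector [0, [:0, 1:], 1]))) t = ceval G (vector [0, t, 1])"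
  by (simp only: poly_msubst_poly vector_3 poly_cpoly_linear map_poly_0 map_poly_1 poly_0 poly_pCons
      of_real_0 of_real_1 mult_1_right mult_zero_right add_0_left add_0_right)

text \<open>For \<open>Im t > 0\<close> the last two coordinates of \<open>(y, a + t, b + t)\<close>
  lie in the upper half-plane, which gives the first claim. For the second, a square root
  \<open>s\<close> of a zero \<open>\<zeta>\<close> with \<open>Re s > 0\<close> would put the
  multiple \<open>(0, i s, i / s)\<close> of \<open>(0, \<zeta>, 1)\<close> into the zero-free
  region.\<close>

lemma stable_imp_hyperbolic:
  assumes st: "stable_symbol F" and F: "F \<noteq> 0" and d: "total_degree F = d"
    and hom: "is_homogenization d F G"
  shows "garding_hyperbolic G (vector [0, 1, 1])"
    and "complex_zeros (msubst_poly G (vector [0, [:0, 1:], 1])) \<subseteq> complex_of_real ` {..0}"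
proof -
  note nz = stable_homogenization_nonzero[OF st F d hom]
  have hd: "homogeneous d G"
    using hom by (simp add: is_homogenization_def)
  have "ceval G (vector [of_real 0, \<i>, \<i>]) \<noteq> 0"
    by (rule nz) auto
  then have "ceval G (vector [of_real 0, of_real 1, of_real 1]) \<noteq> 0"
    using ceval_3_homogeneous[OF hd, of \<i> 0 1 1] by simp
  then have "meval G (vector [0, 1, 1]) \<noteq> 0"
    unfolding ceval_3_of_real by simp
  moreover have "only_real_zeros (msubst_poly G (\<chi> i. [:\<alpha> $ i, (vector [0, 1, 1] :: real ^ 3) $ i:]))" for \<alpha>
    unfolding only_real_zeros_iff poly_line_restriction by (intro allI impI nz) simp_all
  ultimately show "garding_hyperbolic G (vector [0, 1, 1])"
    using hd by (auto simp: garding_hyperbolic_def)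
  show "complex_zeros (msubst_poly G (vector [0, [:0, 1:], 1])) \<subseteq> complex_of_real ` {..0}"
  proof
    fix \<zeta> assume "\<zeta> \<in> complex_zeros (msubst_poly G (vector [0, [:0, 1:], 1]))"
    then have \<zeta>: "ceval G (vector [0, \<zeta>, 1]) = 0"
      by (simp add: complex_zeros_def poly_leading_restriction)
    \<comment> \<open>The principal branch has \<open>Re s \<ge> 0\<close>, so only
      \<open>Re s > 0\<close> has to be excluded; \<open>Re s = 0\<close> gives
      \<open>\<zeta> = - (Im s)^2\<close>.\<close>
    define s where "s = csqrt \<zeta>"
    have s2: "s\<^sup>2 = \<zeta>" by (simp add: s_def)
    have "Re s = 0"
    proof (rule ccontr)
      assume "Re s \<noteq> 0"
      then have s: "Re s > 0"
        using csqrt_principal[of \<zeta>] by (auto simp: s_def)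
      then have s0: "s \<noteq> 0" by auto
      have "ceval G (vector [of_real 0, \<i> * s, \<i> / s]) \<noteq> 0"
        using s s0 by (intro nz) (auto simp: Im_divide intro!: divide_pos_pos sum_power2_gt_zero_iff[THEN iffD2])
      moreover have "vector [of_real 0, \<i> * s, \<i> / s] = (vector [\<i> / s * 0, \<i> / s * \<zeta>, \<i> / s * 1] :: complex ^ 3)"
        using s0 by (simp add: s2[symmetric] power2_eq_square)
      moreover have "ceval G (vector [\<i> / s * 0, \<i> / s * \<zeta>, \<i> / s * 1]) = 0"
        unfolding ceval_3_homogeneous[OF hd] \<zeta> by simp
      ultimately show False by metis
    qed
    then have "s = \<i> * of_real (Im s)"
      by (simp add: complex_eq_iff)
    then have "\<zeta> = (\<i> * of_real (Im s))\<^sup>2"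
      using s2 by metis
    then have "\<zeta> = of_real (- (Im s)\<^sup>2)"
      by (simp add: power_mult_distrib)
    then show "\<zeta> \<in> complex_of_real ` {..0}"
      by (rule image_eqI) simp
  qed
qed

section \<open>Hyperbolicity implies stability: Garding's homotopy\<close>

text \<open>Division by \<open>s\<close> gives the point
  \<open>(x / s, a + y / s, b + z / s)\<close>, which is close to \<open>(0, a, b)\<close> for large
  \<open>s\<close>. Hence the roots along this direction stay in a fixed disc while the base point
  moves in a bounded set.\<close>

lemma homogeneous_root_bound:
  fixes G :: "3 mpoly"
  assumes hd: "homogeneous d G" and nz: "ceval G (vector [0, a, b]) \<noteq> 0"
  obtains C where "C \<ge> 0"
    "\<And>s x y z. norm x \<le> M \<Longrightarrow> norm y \<le> M \<Longrightarrow> norm z \<le> M \<Longrightarrow> norm s > C \<Longrightarrow>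
       ceval G (vector [x, s * a + y, s * b + z]) \<noteq> 0"
proof -
  define f where "f p = ceval G (vector [fst p, a + fst (snd p), b + snd (snd p)])" for p :: "complex \<times> complex \<times> complex"
  have "continuous_on UNIV f"
    unfolding f_def[abs_def] by (intro continuous_intros)
  then have "f \<midarrow>0\<rightarrow> f 0"
    by (metis UNIV_I continuous_on_eq_continuous_at isContD open_UNIV)
  moreover have f0: "f 0 \<noteq> 0"
    using nz by (simp add: f_def)
  ultimately have "\<forall>\<^sub>F p in at 0. f p \<noteq> 0"
    using tendsto_imp_eventually_ne by blast
  then obtain r where r: "r > 0" "\<And>p. p \<noteq> 0 \<Longrightarrow> dist p 0 < r \<Longrightarrow> f p \<noteq> 0"
    by (auto simp: eventually_at)
  have r': "f p \<noteq> 0" if "norm p < r" for p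
    using that r(2)[of p] f0 by (cases "p = 0") auto
  define C where "C = (3 * \<bar>M\<bar>) / r"
  show ?thesis
  proof (rule that[of C])
    show "C \<ge> 0" using r by (simp add: C_def)
    fix s x y z :: complex
    assume M: "norm x \<le> M" "norm y \<le> M" "norm z \<le> M" and s: "norm s > C"
    have s0: "norm s > 0" using s \<open>C \<ge> 0\<close> by linarith
    then have "s \<noteq> 0" by auto
    have "norm (x / s, y / s, z / s) \<le> norm (x / s) + (norm (y / s) + norm (z / s))"
      by (meson norm_Pair_le order_trans add_left_mono)
    also have "\<dots> = (norm x + norm y + norm z) / norm s"
      by (simp add: norm_divide add_divide_distrib)
    also have "\<dots> \<le> 3 * \<bar>M\<bar> / norm s"
      using M s0 by (intro divide_right_mono) auto
    also have "\<dots> < r"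
      using s s0 r(1) by (simp add: C_def field_simps)
    finally have "f (x / s, y / s, z / s) \<noteq> 0"
      by (rule r')
    moreover have "ceval G (vector [x, s * a + y, s * b + z]) =
        ceval G (vector [s * (x / s), s * (a + y / s), s * (b + z / s)])"
      using \<open>s \<noteq> 0\<close> by (simp add: algebra_simps)
    then have "ceval G (vector [x, s * a + y, s * b + z]) = s ^ d * f (x / s, y / s, z / s)"
      unfolding ceval_3_homogeneous[OF hd] by (simp only: f_def fst_conv snd_conv)
    ultimately show "ceval G (vector [x, s * a + y, s * b + z]) \<noteq> 0"
      using \<open>s \<noteq> 0\<close> by simp
  qed
qed

lemma connected_interval_closed_cover:
  fixes A B :: "real set"
  assumes "closed A" "closed B" "{0..1} \<subseteq> A \<union> B" "A \<inter> B \<inter> {0..1} = {}" "0 \<in> A"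
  shows "{0..1} \<inter> B = {}"
proof (rule ccontr)
  assume "{0..1} \<inter> B \<noteq> {}"
  moreover have "A \<inter> {0..1} \<noteq> {}" using assms by force
  moreover have "connected {0..1::real}" by simp
  ultimately show False
    using assms unfolding connected_closed by (metis inf_commute)
qed

text \<open>With \<open>v = (0, a, b)\<close>: as \<open>\<xi>\<close> moves from \<open>0\<close> to \<open>(1, \<alpha>, \<beta>)\<close>, no root \<open>s\<close> of
  \<open>G (\<xi> + s v + \<i> \<delta> e)\<close> can cross the real axis, because \<open>G\<close> is hyperbolic with respect to \<open>e = (0, 1, 1)\<close>.\<close>

lemma hyperbolic_homotopy:
  fixes G :: "3 mpoly"
  assumes hd: "homogeneous d G"
    and hyp: "\<And>y a b t. Im t > 0 \<Longrightarrow> ceval G (vector [of_real y, of_real a + t, of_real b + t]) \<noteq> 0"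
    and top: "\<And>u v. Im u > 0 \<Longrightarrow> Im v > 0 \<Longrightarrow> ceval G (vector [0, u, v]) \<noteq> 0"
    and ab: "a > 0" "b > 0" and nz: "ceval G (vector [0, of_real a, of_real b]) \<noteq> 0"
    and \<delta>: "\<delta> > 0" and s: "Im s > 0"
  shows "ceval G (vector [1, s * of_real a + (\<i> * of_real \<delta> + of_real \<alpha>), s * of_real b + (\<i> * of_real \<delta> + of_real \<beta>)]) \<noteq> 0"
proof -
  define f where "f r s = ceval G (vector [of_real r, s * of_real a + (\<i> * of_real \<delta> + of_real r * of_real \<alpha>),
      s * of_real b + (\<i> * of_real \<delta> + of_real r * of_real \<beta>)])" for r s
  have cont: "continuous_on UNIV (\<lambda>(r, s). f r s)"
    unfolding f_def case_prod_unfold by (intro continuous_intros)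
  \<comment> \<open>For real \<open>s\<close> the point lies on a line through a real point in
    direction \<open>(0, 1, 1)\<close>, at the nonreal parameter \<open>i \<delta>\<close>.\<close>
  have real: "f r s \<noteq> 0" if "Im s = 0" for r s
  proof -
    define c where "c = Re s"
    have s: "s = of_real c" using that by (simp add: complex_eq_iff c_def)
    have *: "s * of_real p + (\<i> * of_real \<delta> + of_real r * of_real x) = of_real (c * p + r * x) + \<i> * of_real \<delta>" for p x
      unfolding s of_real_add of_real_mult by (simp only: ac_simps)
    have "f r s = ceval G (vector [of_real r, of_real (c * a + r * \<alpha>) + \<i> * of_real \<delta>,
        of_real (c * b + r * \<beta>) + \<i> * of_real \<delta>])"
      unfolding f_def * ..
    also have "\<dots> \<noteq> 0" using \<delta> by (intro hyp) simp
    finally show ?thesis .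
  qed
  define M where "M = 1 + \<delta> + \<bar>\<alpha>\<bar> + \<bar>\<beta>\<bar>"
  obtain C where C: "C \<ge> 0"
    "\<And>s x y z. norm x \<le> M \<Longrightarrow> norm y \<le> M \<Longrightarrow> norm z \<le> M \<Longrightarrow> norm s > C \<Longrightarrow>
       ceval G (vector [x, s * of_real a + y, s * of_real b + z]) \<noteq> 0"
    using homogeneous_root_bound[OF hd nz, of M] by metis
  have bnd: "f r s \<noteq> 0" if r: "r \<in> {0..1}" and s: "norm s > C" for r s
    unfolding f_def
  proof (rule C(2)[OF _ _ _ s])
    have *: "norm (\<i> * of_real \<delta> + of_real r * of_real x :: complex) \<le> \<delta> + \<bar>x\<bar>" for x
    proof -
      have "norm (\<i> * of_real \<delta> + of_real r * of_real x :: complex) \<le> \<delta> + \<bar>r\<bar> * \<bar>x\<bar>"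
        using \<delta> by (intro order.trans[OF norm_triangle_ineq]) (simp add: norm_mult)
      also have "\<bar>r\<bar> * \<bar>x\<bar> \<le> 1 * \<bar>x\<bar>" using r by (intro mult_right_mono) auto
      finally show ?thesis by simp
    qed
    have "norm (complex_of_real r) \<le> 1" using r by simp
    then show "norm (complex_of_real r) \<le> M"
      using \<delta> abs_ge_zero[of \<alpha>] abs_ge_zero[of \<beta>] unfolding M_def by linarith
    show "norm (\<i> * of_real \<delta> + of_real r * of_real \<alpha> :: complex) \<le> M"
      using *[of \<alpha>] abs_ge_zero[of \<beta>] unfolding M_def by linarith
    show "norm (\<i> * of_real \<delta> + of_real r * of_real \<beta> :: complex) \<le> M"
      using *[of \<beta>] abs_ge_zero[of \<alpha>] unfolding M_def by linarith
  qed
  define A where "A = {r \<in> {0..1}. \<forall>s. Im s > 0 \<longrightarrow> f r s \<noteq> 0}"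
  define B where "B = {r \<in> {0..1}. \<exists>s. Im s > 0 \<and> f r s = 0}"
  \<comment> \<open>Zero-freeness passes to limits by Hurwitz' theorem, with a point outside the
    disc of radius \<open>C\<close> as anchor.\<close>
  have "closed A"
    unfolding closed_sequential_limits
  proof (intro allI impI, elim conjE)
    fix x l assume x: "\<forall>n. x n \<in> A" and l: "x \<longlonglongrightarrow> l"
    have l01: "l \<in> {0..1}"
      using closed_sequentially[of "{0..1::real}" x l] x l by (auto simp: A_def)
    have "f l (\<i> * of_real (C + 1)) \<noteq> 0"
      using C(1) by (intro bnd l01) (simp add: norm_mult)
    note z1 = this
    have "f l s \<noteq> 0" if "Im s > 0" for s
    proof (rule hurwitz_param[OF open_upper_half connected_upper_half cont _ l _ _ z1])
      show "f r holomorphic_on {z. 0 < Im z}" for r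
        unfolding f_def[abs_def] by (intro holomorphic_intros)
      show "f (x n) z \<noteq> 0" if "z \<in> {z. 0 < Im z}" for n z
        using x that unfolding A_def by blast
      show "\<i> * of_real (C + 1) \<in> {z. 0 < Im z}" using C(1) by simp
      show "s \<in> {z. 0 < Im z}" using that by simp
    qed
    then show "l \<in> A" using l01 by (simp add: A_def)
  qed
  moreover have "closed B"
  proof -
    \<comment> \<open>\<open>B\<close> is the projection of a compact set: roots are bounded by
      \<open>C\<close>, and \<open>Im s > 0\<close> may be relaxed to \<open>Im s \<ge> 0\<close>
      because real roots do not occur.\<close>
    define K where "K = {0..1} \<times> (cball 0 C \<inter> {s. Im s \<ge> 0}) \<inter> {p. f (fst p) (snd p) = 0}"
    have "compact K"
      unfolding K_def
      using cont by (intro compact_Int_closed compact_Times closed_Collect_eq closed_halfspace_Im_ge)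
        (auto simp: case_prod_unfold)
    then have "compact (fst ` K)"
      by (intro compact_continuous_image continuous_intros)
    moreover have "B = fst ` K"
    proof safe
      fix r assume "r \<in> B"
      then obtain s where s: "r \<in> {0..1}" "Im s > 0" "f r s = 0" by (auto simp: B_def)
      then have "norm s \<le> C" using bnd not_le by blast
      with s have "(r, s) \<in> K" by (simp add: K_def)
      then show "r \<in> fst ` K" by force
    next
      fix r s assume "(r, s) \<in> K"
      then have *: "r \<in> {0..1}" "Im s \<ge> 0" "f r s = 0" by (auto simp: K_def)
      with real have "Im s \<noteq> 0" by blast
      with * show "fst (r, s) \<in> B" by (auto simp: B_def intro!: exI[of _ s])
    qed
    ultimately show ?thesis by (simp add: compact_imp_closed)
  qed
  \<comment> \<open>At \<open>r = 0\<close> the last two coordinates lie in the upper half-plane, as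
    \<open>a\<close>, \<open>b\<close> and \<open>\<delta>\<close> are positive.\<close>
  moreover have "0 \<in> A"
  proof -
    have "f 0 s \<noteq> 0" if "Im s > 0" for s
    proof -
      have "ceval G (vector [0, s * of_real a + \<i> * of_real \<delta>, s * of_real b + \<i> * of_real \<delta>]) \<noteq> 0"
        using that ab \<delta> by (intro top) (simp_all add: add_pos_pos)
      then show ?thesis by (simp add: f_def)
    qed
    then show ?thesis by (simp add: A_def)
  qed
  ultimately have "{0..1} \<inter> B = {}"
    by (intro connected_interval_closed_cover[of A B]) (auto simp: A_def B_def)
  moreover have "1 \<in> {0..1::real}" by simp
  ultimately have "1 \<notin> B" by blast
  then show ?thesis
    using s by (auto simp: B_def f_def)
qed

text \<open>With \<open>a = Im z\<close> and \<open>b = Im w\<close>, the point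
  \<open>(1, z, w)\<close> is reached from the real point \<open>(1, Re z, Re w)\<close> in
  direction \<open>(0, a, b)\<close> at \<open>s = i\<close>. The homotopy applies after an extra
  shift by \<open>i e (0, 1, 1)\<close> with \<open>e > 0\<close>, which Hurwitz' theorem removes in
  the limit.\<close>

lemma hyperbolic_imp_stable:
  assumes hom: "is_homogenization d F G"
    and hyp: "garding_hyperbolic G (vector [0, 1, 1])"
    and zeros: "complex_zeros (msubst_poly G (vector [0, [:0, 1:], 1])) \<subseteq> complex_of_real ` {..0}"
  shows "stable_symbol F"
  unfolding stable_symbol_def
proof (intro allI impI)
  fix z w assume z: "Im z > 0" and w: "Im w > 0"
  have hd: "homogeneous d G"
    using hom by (simp add: is_homogenization_def)
  have line: "ceval G (vector [of_real y, of_real a + t, of_real b + t]) \<noteq> 0" if "Im t > 0" for y a b t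
  proof -
    have "only_real_zeros (msubst_poly G (\<chi> i. [:(vector [y, a, b] :: real ^ 3) $ i, (vector [0, 1, 1] :: real ^ 3) $ i:]))"
      using hyp by (simp add: garding_hyperbolic_def)
    then show ?thesis
      unfolding only_real_zeros_iff poly_line_restriction using that by simp
  qed
  \<comment> \<open>By homogeneity, condition (ii) confines the zeros with \<open>y = 0\<close> and
    \<open>v \<noteq> 0\<close> to \<open>u = r v\<close> with \<open>r \<le> 0\<close>. This
    excludes \<open>u\<close>, \<open>v\<close> both in the upper half-plane and \<open>u\<close>,
    \<open>v\<close> both positive.\<close>
  have ray: "ceval G (vector [0, u, v]) \<noteq> 0" if v: "v \<noteq> 0" and uv: "\<And>r. r \<le> 0 \<Longrightarrow> u \<noteq> of_real r * v" for u v
  proof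
    assume "ceval G (vector [0, u, v]) = 0"
    moreover have "vector [0, u, v] = (vector [v * 0, v * (u / v), v * 1] :: complex ^ 3)"
      using v by simp
    ultimately have "ceval G (vector [0, u / v, 1]) = 0"
      using v by (simp only: ceval_3_homogeneous[OF hd] mult_eq_0_iff power_eq_0_iff) auto
    then have "u / v \<in> complex_zeros (msubst_poly G (vector [0, [:0, 1:], 1]))"
      by (simp add: complex_zeros_def poly_leading_restriction)
    then obtain r where "r \<le> 0" "u / v = of_real r" using zeros by auto
    with uv[of r] v show False by (auto simp: field_simps)
  qed
  have top: "ceval G (vector [0, u, v]) \<noteq> 0" if uv: "Im u > 0" "Im v > 0" for u v
  proof (rule ray)
    show "v \<noteq> 0" using uv by auto
    fix r :: real assume "r \<le> 0"
    then have "Im (of_real r * v) \<le> 0" using uv by (simp add: mult_nonpos_nonneg)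
    then show "u \<noteq> of_real r * v" using uv by auto
  qed
  define a b where "a = Im z" and "b = Im w"
  have ab: "a > 0" "b > 0" using z w by (auto simp: a_def b_def)
  have pos: "ceval G (vector [0, of_real a, of_real b]) \<noteq> 0"
  proof (rule ray)
    show "complex_of_real b \<noteq> 0" using ab by simp
    fix r :: real assume "r \<le> 0"
    then have "r * b \<le> 0" using ab by (simp add: mult_nonpos_nonneg)
    then have "a \<noteq> r * b" using ab by linarith
    then show "complex_of_real a \<noteq> of_real r * of_real b"
      by (metis of_real_eq_iff of_real_mult)
  qed
  define H where "H e s = ceval G (vector [1, s * of_real a + (\<i> * of_real e + of_real (Re z)),
      s * of_real b + (\<i> * of_real e + of_real (Re w))])" for e s
  obtain C where C: "C \<ge> 0"
    "\<And>s x y z'. norm x \<le> 1 + norm z + norm w \<Longrightarrow> norm y \<le> 1 + norm z + norm w \<Longrightarrow> norm z' \<le> 1 + norm z + norm w \<Longrightarrow> norm s > C \<Longrightarrow>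
       ceval G (vector [x, s * of_real a + y, s * of_real b + z']) \<noteq> 0"
    using homogeneous_root_bound[OF hd pos, of "1 + norm z + norm w"] by metis
  have "H 0 (\<i> * of_real (C + 1)) \<noteq> 0"
    unfolding H_def using C(1) abs_Re_le_cmod[of z] abs_Re_le_cmod[of w]
    by (intro C(2)) (auto simp: norm_mult intro: order.trans)
  then have "H 0 \<i> \<noteq> 0"
  proof (rule hurwitz_param[of "{z. Im z > 0}" H "\<lambda>n. 1 / real (Suc n)" 0 "\<i> * of_real (C + 1)", OF open_upper_half connected_upper_half, rotated 5])
    show "continuous_on UNIV (\<lambda>(e, z). H e z)"
      unfolding H_def case_prod_unfold by (intro continuous_intros)
    show "H e holomorphic_on {z. 0 < Im z}" for e
      unfolding H_def by (intro holomorphic_intros)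
    show "(\<lambda>n. 1 / real (Suc n)) \<longlonglongrightarrow> 0"
      using LIMSEQ_inverse_real_of_nat by (simp add: inverse_eq_divide)
    show "H (1 / real (Suc n)) s \<noteq> 0" if "s \<in> {z. 0 < Im z}" for n s
      unfolding H_def by (rule hyperbolic_homotopy[OF hd line top ab pos]) (use that in auto)
  qed (use C(1) in auto)
  moreover have "\<i> * of_real a + of_real (Re z) = z" "\<i> * of_real b + of_real (Re w) = w"
    by (simp_all add: complex_eq_iff a_def b_def)
  ultimately have "ceval G (vector [1, z, w]) \<noteq> 0"
    by (simp add: H_def)
  then show "ceval F (vector [z, - w]) \<noteq> 0"
    by (simp add: is_homogenization_complex[OF hom])
qed

theorem theorem6p9:
  fixes T :: "real poly \<Rightarrow> real poly" and d :: nat and Ft :: "3 mpoly"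
  assumes "T \<in> diff_ops"
    and "T \<noteq> (\<lambda>_. 0)"
    and "total_degree (op_symbol T) = d"
    and "is_homogenization d (op_symbol T) Ft"
  shows "T \<in> hyperbolicity_preservers \<longleftrightarrow>
    garding_hyperbolic Ft (vector [0, 1, 1]) \<and>
    complex_zeros (msubst_poly Ft (vector [0, [:0, 1:], 1])) \<subseteq> complex_of_real ` {..0}"
proof -
  obtain F where T: "T = diff_op F"
    using assms(1) unfolding diff_ops_def by (rule rangeE)
  have d: "total_degree F = d" and hom: "is_homogenization d F Ft"
    using assms(3,4) by (simp_all add: T op_symbol_diff_op)
  have F: "F \<noteq> 0"
    using assms(2) by (auto simp: T diff_op_def fun_eq_iff)
  have "T \<in> hyperbolicity_preservers \<longleftrightarrow> T ` real_rooted \<subseteq> real_rooted \<union> {0}"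
    using assms(1,2) by (simp add: hyperbolicity_preservers_def)
  also have "\<dots> \<longleftrightarrow> stable_symbol F"
    using preserver_imp_stable[OF F] stable_imp_real_rooted unfolding T by blast
  also have "\<dots> \<longleftrightarrow> garding_hyperbolic Ft (vector [0, 1, 1]) \<and>
    complex_zeros (msubst_poly Ft (vector [0, [:0, 1:], 1])) \<subseteq> complex_of_real ` {..0}"
    using stable_imp_hyperbolic[OF _ F d hom] hyperbolic_imp_stable[OF hom] by blast
  finally show ?thesis .
qed

end
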